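(* Let $\Phi$ be the map defined in the context below. Then $\Phi$ is a bijection from the set of triangulations of the strip to the set of $\mathrm{SL}_2$-tilings with enough ones.
   Context: Vertices of the strip: two disjoint copies of $\mathbb{Z}$, written $\mathbb{Z}^\circ=\{p^\circ: p\in\mathbb{Z}\}$ (upper edge) and $\mathbb{Z}_\circ=\{q_\circ : q\in\mathbb{Z}\}$ (lower edge). Geometrically, $p^\circ$ is the point $(-p,1)$ and $q_\circ$ is the point $(q,-1)$ of the strip $\mathbb{R}\times[-1,1]$ (so the two edges are numbered in opposite directions). A connecting arc is a pair $(p^\circ,q_\circ)$ with $p,q\in\mathbb{Z}$; an internal arc is a pair $(p^\circ,q^\circ)$ or $(p_\circ,q_\circ)$ with $p\le q-2$. Arcs are drawn as curves inside the strip joining their endpoints. Two distinct arcs cross exactly in the following cases: connecting arcs $(p^\circ,q_\circ),(p'^\circ,q'_\circ)$ cross iff $(p-p')(q-q')>0$; internal arcs $(a^\circ,b^\circ),(c^\circ,d^\circ)$ cross iff $a<c<b<d$ or $c<a<d<b$ (same for lower internal arcs $(a_\circ,b_\circ),(c_\circ,d_\circ)$); an internal arc $(a^\circ,b^\circ)$ crosses a connecting arc $(p^\circ,q_\circ)$ iff $a<p<b$, and $(a_\circ,b_\circ)$ crosses $(p^\circ,q_\circ)$ iff $a<q<b$; an upper internal arc never crosses a lower internal arc. (Arcs sharing only endpoints do not cross.) A triangulation of the strip is a maximal set $\mathfrak{T}$ of pairwise non-crossing arcs such that for every $(i,j)\in\mathbb{Z}^2$ there is $(p^\circ,q_\circ)\in\mathfrak{T}$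 with $p<i,\ q>j$, and there is $(p^\circ,q_\circ)\in\mathfrak{T}$ with $p>i,\ q<j$. An $\mathrm{SL}_2$-tiling is a map $t:\mathbb{Z}\times\mathbb{Z}\to\{1,2,3,\dots\}$, $(i,j)\mapsto t_{ij}$, with $t_{ij}t_{i+1,j+1}-t_{i,j+1}t_{i+1,j}=1$ for all $i,j$. It has enough ones if for every $(i,j)$ there is $(p,q)$ with $p<i,\ q>j$ and $t_{pq}=1$, and there is $(p,q)$ with $p>i,\ q<j$ and $t_{pq}=1$. Friese numbers of a triangulated polygon: let $P$ be a convex polygon with vertices $v_0,\dots,v_n$ in cyclic order ($n\ge 2$), with a triangulation $\mathcal{X}$; let $a_l$ be the number of triangles of $\mathcal{X}$ incident with $v_l$. For fixed $k$ define $m_k(l)$ for $l=k,k+1,\dots,k+n$ (indices mod $n+1$) by $m_k(k)=0$, $m_k(k+1)=1$, $m_k(l+1)=a_l m_k(l)-m_k(l-1)$, and put $\mathcal{X}(v_k,v_l)=m_k(l)$ (this is the Conway–Coxeter friese value; it is symmetric and a positive integer for $k\ne l$). The map $\Phi$: given a triangulation $\mathfrak{T}$ of the strip and $(i,j)\in\mathbb{Z}^2$, choose $(p^\circ,q_\circ),(r^\circ,s_\circ)\in\mathfrak{T}$ with $p<i<r$ and $s<j<q$. Let $P$ be the polygon with vertices, in cyclic order, $p^\circ,(p+1)^\circ,\dots,r^\circ,s_\circ,(s+1)_\circ,\dots,q_\circ$; the arcs of $\mathfrak{T}$ joining two vertices of $P$ other than the sides of $P$ form a triangulation $\mathfrak{T}_P$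 of $P$. Set $\Phi(\mathfrak{T})_{ij}=\mathfrak{T}_P(i^\circ,j_\circ)$. *)

theory Defs
  imports Main
begin

text \<open>Up p is the upper vertex p-circ (the point (-p,1)); Lo q is the lower vertex q-sub-circ
  (the point (q,-1)).\<close>
datatype vert = Up int | Lo int

datatype arc = Conn int int | UArc int int | LArc int int

fun is_arc :: "arc \<Rightarrow> bool" where
  "is_arc (Conn p q) = True"
| "is_arc (UArc a b) = (a \<le> b - 2)"
| "is_arc (LArc a b) = (a \<le> b - 2)"

fun endpoints :: "arc \<Rightarrow> vert set" where
  "endpoints (Conn p q) = {Up p, Lo q}"
| "endpoints (UArc a b) = {Up a, Up b}"
| "endpoints (LArc a b) = {Lo a, Lo b}"

fun crosses :: "arc \<Rightarrow> arc \<Rightarrow> bool" where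
  "crosses (Conn p q) (Conn p' q') = ((p - p') * (q - q') > 0)"
| "crosses (UArc a b) (UArc c d) = ((a < c \<and> c < b \<and> b < d) \<or> (c < a \<and> a < d \<and> d < b))"
| "crosses (LArc a b) (LArc c d) = ((a < c \<and> c < b \<and> b < d) \<or> (c < a \<and> a < d \<and> d < b))"
| "crosses (UArc a b) (Conn p q) = (a < p \<and> p < b)"
| "crosses (Conn p q) (UArc a b) = (a < p \<and> p < b)"
| "crosses (LArc a b) (Conn p q) = (a < q \<and> q < b)"
| "crosses (Conn p q) (LArc a b) = (a < q \<and> q < b)"
| "crosses (UArc a b) (LArc c d) = False"
| "crosses (LArc a b) (UArc c d) = False"

definition is_triangulation :: "arc set \<Rightarrow> bool" where
  "is_triangulation T \<longleftrightarrow>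
     (\<forall>x\<in>T. is_arc x) \<and>
     (\<forall>x\<in>T. \<forall>y\<in>T. x \<noteq> y \<longrightarrow> \<not> crosses x y) \<and>
     (\<forall>z. is_arc z \<and> z \<notin> T \<longrightarrow> (\<exists>x\<in>T. x \<noteq> z \<and> crosses z x)) \<and>
     (\<forall>i j. (\<exists>p q. Conn p q \<in> T \<and> p < i \<and> q > j) \<and>
            (\<exists>p q. Conn p q \<in> T \<and> p > i \<and> q < j))"

definition is_SL2_tiling :: "(int \<Rightarrow> int \<Rightarrow> int) \<Rightarrow> bool" where
  "is_SL2_tiling t \<longleftrightarrow>
     (\<forall>i j. t i j \<ge> 1) \<and>
     (\<forall>i j. t i j * t (i+1) (j+1) - t i (j+1) * t (i+1) j = 1)"

definition enough_ones :: "(int \<Rightarrow> int \<Rightarrow> int) \<Rightarrow> bool" where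
  "enough_ones t \<longleftrightarrow>
     (\<forall>i j. (\<exists>p q. p < i \<and> q > j \<and> t p q = 1) \<and>
            (\<exists>p q. p > i \<and> q < j \<and> t p q = 1))"

text \<open>A polygon is given by the list vs of its vertices v_0,...,v_n in cyclic order;
  D is its set of diagonals (each a two-element set of vertices).\<close>

definition poly_sides :: "'v list \<Rightarrow> 'v set set" where
  "poly_sides vs = {{vs ! i, vs ! ((i + 1) mod length vs)} | i. i < length vs}"

definition poly_adj :: "'v list \<Rightarrow> 'v set set \<Rightarrow> 'v \<Rightarrow> 'v \<Rightarrow> bool" where
  "poly_adj vs D x y \<longleftrightarrow> x \<noteq> y \<and> x \<in> set vs \<and> y \<in> set vs \<and>
     ({x, y} \<in> D \<or> {x, y} \<in> poly_sides vs)"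

definition poly_triangles :: "'v list \<Rightarrow> 'v set set \<Rightarrow> 'v set set" where
  "poly_triangles vs D = {{x, y, z} | x y z.
      poly_adj vs D x y \<and> poly_adj vs D y z \<and> poly_adj vs D x z}"

definition tri_count :: "'v list \<Rightarrow> 'v set set \<Rightarrow> nat \<Rightarrow> int" where
  "tri_count vs D l = int (card {S \<in> poly_triangles vs D. vs ! l \<in> S})"

text \<open>friese_seq a N k d = m_k(k + d), indices mod N = n+1.\<close>
fun friese_seq :: "(nat \<Rightarrow> int) \<Rightarrow> nat \<Rightarrow> nat \<Rightarrow> nat \<Rightarrow> int" where
  "friese_seq a N k 0 = 0"
| "friese_seq a N k (Suc 0) = 1"
| "friese_seq a N k (Suc (Suc d)) =
     a ((k + Suc d) mod N) * friese_seq a N k (Suc d) - friese_seq a N k d"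

definition vidx :: "'v list \<Rightarrow> 'v \<Rightarrow> nat" where
  "vidx vs x = (THE k. k < length vs \<and> vs ! k = x)"

definition friese_val :: "'v list \<Rightarrow> 'v set set \<Rightarrow> 'v \<Rightarrow> 'v \<Rightarrow> int" where
  "friese_val vs D x y =
     (let N = length vs; k = vidx vs x; l = vidx vs y
      in friese_seq (tri_count vs D) N k ((l + N - k) mod N))"

definition strip_poly :: "int \<Rightarrow> int \<Rightarrow> int \<Rightarrow> int \<Rightarrow> vert list" where
  "strip_poly p r s q = map Up [p..r] @ map Lo [s..q]"

definition restrict_triang :: "arc set \<Rightarrow> vert list \<Rightarrow> vert set set" where
  "restrict_triang T vs =
     {e. \<exists>x\<in>T. e = endpoints x \<and> e \<subseteq> set vs} - poly_sides vs"

definition Phi :: "arc set \<Rightarrow> int \<Rightarrow> int \<Rightarrow> int" where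
  "Phi T i j =
     (let (p, q, r, s) = (SOME (p, q, r, s). Conn p q \<in> T \<and> Conn r s \<in> T \<and>
                              p < i \<and> i < r \<and> s < j \<and> j < q);
          vs = strip_poly p r s q
      in friese_val vs (restrict_triang T vs) (Up i) (Lo j))"

end

theory Submission
  imports Defs
begin

text \<open>
  Label every vertex of the strip by a vector of \<open>\<int>\<^sup>2\<close> so that the two ends of each arc and each
  boundary edge have determinant 1. In a triangulated polygon such a labelling exists, as the apex of
  a triangle must carry the sum of the labels of its base, and it is compatible with passing to a
  subpolygon. Its determinants are positive, are 1 exactly on the arcs and sides, and
  count the triangles at a vertex as the determinant of its two neighbours; the Pluecker relation
  is then the recurrence of the friese numbers, so \<open>\<Phi>\<close> is given by determinants. Hence \<open>\<Phi> T\<close> is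
  an SL2-tiling, from which \<open>T\<close> is recovered as the set of arcs of determinant 1. Conversely, a
  tiling \<open>t\<close> has rank 2, so it comes from a labelling of all vertices. The arcs of determinant 1
  do not cross by the Pluecker relation, and they are a maximal such set because any
  unimodular polygon contains a triangle on each of its sides.
\<close>

section \<open>Triangulated polygons with vertices numbered \<open>a, \<dots>, b\<close>\<close>

text \<open>Noncrossing and maximality are fused into one equivalence: left to right, edges do not
  cross; right to left, an uncrossed pair is an edge. Sides and the base from \<open>a\<close> to
  \<open>b\<close> are thereby edges, so they need no treatment apart from diagonals.\<close>

definition triangulates :: "(nat \<Rightarrow> nat \<Rightarrow> bool) \<Rightarrow> nat \<Rightarrow> nat \<Rightarrow> bool" where
  "triangulates E a b \<longleftrightarrow> (\<forall>i j. a \<le> i \<and> i < j \<and> j \<le> b \<longrightarrow>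
     (E i j \<longleftrightarrow> \<not> (\<exists>k l. a \<le> k \<and> k < l \<and> l \<le> b \<and> E k l \<and>
        (i < k \<and> k < j \<and> j < l \<or> k < i \<and> i < l \<and> l < j))))"

lemma triangulates_noncrossing:
  assumes "triangulates E a b" "E i j" "E k l" "a \<le> i" "i < k" "k < j" "j < l" "l \<le> b"
  shows False
proof -
  have "a \<le> i \<and> i < j \<and> j \<le> b" "a \<le> k" "k < l" using assms by auto
  then show False using assms unfolding triangulates_def by blast
qed

lemma triangulates_crossed:
  assumes "triangulates E a b" "a \<le> i" "i < j" "j \<le> b" "\<not> E i j"
  obtains k l where "a \<le> k" "k < l" "l \<le> b" "E k l"
    "i < k \<and> k < j \<and> j < l \<or> k < i \<and> i < l \<and> l < j"
proof -
  have "\<exists>k l. a \<le> k \<and> k < l \<and> l \<le> b \<and> E k l \<and> (i < k \<and> k < j \<and> j < l \<or> k < i \<and> i < l \<and> l < j)"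
    using assms(1)[unfolded triangulates_def, THEN spec, THEN spec, THEN mp, of i j] assms(2-5)
    by argo
  then show thesis using that by (elim exE conjE) (rule that)
qed

lemma triangulates_edge:
  assumes "triangulates E a b" "a < b"
  shows "E a b"
  using assms unfolding triangulates_def by (metis leD le_refl)

lemma triangulates_side:
  assumes "triangulates E a b" "a \<le> i" "i < b"
  shows "E i (Suc i)"
proof (rule ccontr)
  assume "\<not> E i (Suc i)"
  then obtain k l where "i < k \<and> k < Suc i \<and> Suc i < l \<or> k < i \<and> i < l \<and> l < Suc i"
    by (rule triangulates_crossed[OF assms(1,2), of "Suc i", rotated 2]) (use assms in auto)
  then show False by auto
qed

text \<open>An edge that crosses a pair inside the subpolygon but ends outside it would also cross
  the edge from \<open>c\<close> to \<open>d\<close>. So every crossing relevant to maximality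
  already happens inside.\<close>

lemma triangulates_subpolygon:
  assumes T: "triangulates E a b" and "a \<le> c" "c < d" "d \<le> b" "E c d"
  shows "triangulates E c d"
  unfolding triangulates_def
proof (intro allI impI iffI notI)
  fix i j
  assume ij: "c \<le> i \<and> i < j \<and> j \<le> d" and "E i j"
    and "\<exists>k l. c \<le> k \<and> k < l \<and> l \<le> d \<and> E k l \<and> (i < k \<and> k < j \<and> j < l \<or> k < i \<and> i < l \<and> l < j)"
  then obtain k l where kl: "c \<le> k" "k < l" "l \<le> d" "E k l"
    "i < k \<and> k < j \<and> j < l \<or> k < i \<and> i < l \<and> l < j" by blast
  then show False
    using triangulates_noncrossing[OF T \<open>E i j\<close> \<open>E k l\<close>]
      triangulates_noncrossing[OF T \<open>E k l\<close> \<open>E i j\<close>] ij assms(2-4) kl(1-3,5) by linarith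
next
  fix i j
  assume ij: "c \<le> i \<and> i < j \<and> j \<le> d"
    and no: "\<not> (\<exists>k l. c \<le> k \<and> k < l \<and> l \<le> d \<and> E k l \<and>
      (i < k \<and> k < j \<and> j < l \<or> k < i \<and> i < l \<and> l < j))"
  show "E i j"
  proof (rule ccontr)
    assume "\<not> E i j"
    moreover have "a \<le> i" "i < j" "j \<le> b" using ij assms by auto
    ultimately obtain k l where kl: "a \<le> k" "k < l" "l \<le> b" "E k l"
      "i < k \<and> k < j \<and> j < l \<or> k < i \<and> i < l \<and> l < j"
      by (metis triangulates_crossed[OF T])
    have "\<not> k < c"
      using triangulates_noncrossing[OF T \<open>E k l\<close> \<open>E c d\<close>] kl ij assms(2-4) by auto
    moreover have "\<not> d < l"
      using triangulates_noncrossing[OF T \<open>E c d\<close> \<open>E k l\<close>] kl ij assms(2-4) by auto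
    ultimately have "c \<le> k" "l \<le> d" by auto
    with no kl show False by blast
  qed
qed

text \<open>The apex is the farthest neighbour \<open>k\<close> of \<open>a\<close> before
  \<open>b\<close>. An edge crossing the pair \<open>k\<close>, \<open>b\<close> either starts at
  \<open>a\<close>, against the choice of \<open>k\<close>, or crosses the edge from
  \<open>a\<close> to \<open>k\<close>.\<close>

lemma triangulates_apex:
  assumes T: "triangulates E a b" and "Suc a < b"
  shows "\<exists>k. a < k \<and> k < b \<and> E a k \<and> E k b"
proof -
  let ?S = "{k. a < k \<and> k < b \<and> E a k}"
  have "E a (Suc a)" using triangulates_side[OF T] assms(2) by simp
  then have ne: "Suc a \<in> ?S" using assms(2) by simp
  define k where "k = Max ?S"
  have fin: "finite ?S" by simp
  have k: "k \<in> ?S" unfolding k_def using fin ne by (intro Max_in) auto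
  have mx: "y \<le> k" if "a < y" "y < b" "E a y" for y
    unfolding k_def using fin that by (intro Max_ge) auto
  have "E k b"
  proof (rule ccontr)
    assume "\<not> E k b"
    moreover have "a \<le> k" "k < b" "b \<le> b" using k by auto
    ultimately obtain x y where xy: "a \<le> x" "x < y" "y \<le> b" "E x y"
      "k < x \<and> x < b \<and> b < y \<or> x < k \<and> k < y \<and> y < b"
      by (metis triangulates_crossed[OF T])
    show False
    proof (cases "x = a")
      case True
      then show False using mx[of y] xy k by auto
    next
      case False
      then show False
        using triangulates_noncrossing[OF T, of a k x y] xy k by auto
    qed
  qed
  with k show ?thesis by blast
qed

text \<open>Removing the triangle on the base leaves two smaller triangulated polygons, whose bases
  are the other two sides of this triangle.\<close>

lemma triangulates_induct [consumes 2, case_names edge triangle]: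
  assumes "triangulates E a b" "a < b"
    and base: "\<And>a. E a (Suc a) \<Longrightarrow> P a (Suc a)"
    and step: "\<And>a k b. \<lbrakk>a < k; k < b; E a k; E k b; E a b; triangulates E a b;
      triangulates E a k; triangulates E k b; P a k; P k b\<rbrakk> \<Longrightarrow> P a b"
  shows "P a b"
  using assms(1,2)
proof (induction "b - a" arbitrary: a b rule: less_induct)
  case less
  have ab: "E a b" using triangulates_edge less.prems .
  show ?case
  proof (cases "b = Suc a")
    case True
    then show ?thesis using base ab by simp
  next
    case False
    then obtain k where k: "a < k" "k < b" "E a k" "E k b"
      using triangulates_apex[OF less.prems(1)] less.prems(2) by (metis Suc_lessI)
    then have t: "triangulates E a k" "triangulates E k b"
      using triangulates_subpolygon[OF less.prems(1)] by auto
    have "P a k" using k t by (intro less.hyps) auto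
    moreover have "P k b" using k t by (intro less.hyps) auto
    ultimately show ?thesis using step k t ab less.prems by blast
  qed
qed

section \<open>Determinant labellings of a triangulated polygon\<close>

definition det :: "int \<times> int \<Rightarrow> int \<times> int \<Rightarrow> int" where
  "det u v = fst u * snd v - snd u * fst v"

lemma det_self [simp]: "det u u = 0"
  by (simp add: det_def)

lemma det_swap: "det u v = - det v u"
  by (simp add: det_def)

lemma pluecker: "det x y * det z w = det x z * det y w + det x w * det z y"
  by (simp add: det_def algebra_simps)

definition labels :: "(nat \<Rightarrow> nat \<Rightarrow> bool) \<Rightarrow> nat \<Rightarrow> nat \<Rightarrow> (nat \<Rightarrow> int \<times> int) \<Rightarrow> bool" where
  "labels E a b w \<longleftrightarrow> (\<forall>i j. a \<le> i \<and> i < j \<and> j \<le> b \<and> E i j \<longrightarrow> det (w i) (w j) = 1)"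

lemma labels_mono: "labels E a b w \<Longrightarrow> a \<le> c \<Longrightarrow> d \<le> b \<Longrightarrow> labels E c d w"
  unfolding labels_def by (meson le_trans)

lemma labels_edge: "labels E a b w \<Longrightarrow> a \<le> i \<Longrightarrow> i < j \<Longrightarrow> j \<le> b \<Longrightarrow> E i j \<Longrightarrow> det (w i) (w j) = 1"
  unfolding labels_def by blast

text \<open>An edge passing over the apex crosses the side from \<open>a\<close> to \<open>k\<close>
  if it starts after \<open>a\<close>, and the side from \<open>k\<close> to \<open>b\<close> if it
  ends before \<open>b\<close>.\<close>

lemma triangulates_across:
  assumes T: "triangulates E a b" and "a < k" "k < b" "E a k" "E k b"
    and "a \<le> i" "i < k" "k < j" "j \<le> b" "E i j"
  shows "i = a \<and> j = b"
  using triangulates_noncrossing[OF T, of a k i j] triangulates_noncrossing[OF T, of i j k b] assms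
  by (metis le_neq_implies_less le_refl)

text \<open>The labels of the base are prescribed, so that in the induction both halves can be given
  the same label at the apex and then glued. Only the base passes over the apex, so gluing creates
  no further condition.\<close>

lemma labels_exist:
  assumes "triangulates E a b" "a < b" "det u v = 1"
  shows "\<exists>w. labels E a b w \<and> w a = u \<and> w b = v"
  using assms
proof (induction arbitrary: u v rule: triangulates_induct)
  case (edge a)
  have "labels E a (Suc a) (\<lambda>i. if i = a then u else v)"
    unfolding labels_def using edge.prems by auto
  then show ?case by (intro exI[of _ "\<lambda>i. if i = a then u else v"]) auto
next
  case (triangle a k b)
  define z where "z = (fst u + fst v, snd u + snd v)"
  have "det u z = 1" "det z v = 1"
    using triangle.prems by (auto simp: det_def z_def algebra_simps)
  then obtain w1 w2 where w: "labels E a k w1" "w1 a = u" "w1 k = z"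
      "labels E k b w2" "w2 k = z" "w2 b = v"
    using triangle.IH by meson
  define w where "w i = (if i \<le> k then w1 i else w2 i)" for i
  have "labels E a b w"
    unfolding labels_def
  proof (intro allI impI, elim conjE)
    fix i j assume ij: "a \<le> i" "i < j" "j \<le> b" "E i j"
    consider "j \<le> k" | "k \<le> i" | "i < k" "k < j" by linarith
    then show "det (w i) (w j) = 1"
    proof cases
      case 1
      then show ?thesis using labels_edge[OF w(1), of i j] ij by (auto simp: w_def)
    next
      case 2
      then have "w i = w2 i" "w j = w2 j" using w ij by (auto simp: w_def)
      then show ?thesis using labels_edge[OF w(4), of i j] ij 2 by auto
    next
      case 3
      then have "i = a \<and> j = b"
        using triangulates_across[OF triangle.hyps(6,1,2,3,4)] ij by blast
      then show ?thesis using triangle w by (auto simp: w_def)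
    qed
  qed
  moreover have "w a = u" "w b = v" using triangle w by (auto simp: w_def)
  ultimately show ?case by blast
qed

text \<open>Expands the determinant across the diagonals \<open>ak\<close> and \<open>kb\<close> of a unimodular triangle \<open>akb\<close>.\<close>
lemma det_across_triangle:
  assumes "det u z = 1" "det z v = 1" "det u v = 1"
  shows "det x y = det x z * det y v + det x z * det z y + det u x * det z y"
proof -
  obtain u1 u2 v1 v2 z1 z2 x1 x2 y1 y2
    where e: "u = (u1,u2)" "v = (v1,v2)" "z = (z1,z2)" "x = (x1,x2)" "y = (y1,y2)"
    by (metis surj_pair)
  have 1: "u1 * z2 - u2 * z1 = 1" "z1 * v2 - z2 * v1 = 1" "u1 * v2 - u2 * v1 = 1"
    using assms by (auto simp: e det_def)
  \<comment> \<open>The three unit determinants force \<open>z\<close> to be the sum of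
    \<open>u\<close> and \<open>v\<close>.\<close>
  have z: "z1 = u1 + v1" "z2 = u2 + v2" using 1 by algebra+
  show ?thesis using 1(3) unfolding e det_def z fst_conv snd_conv by algebra
qed

text \<open>For a pair on different sides of the apex, \<open>det_across_triangle\<close> gives
  three nonnegative terms. The middle one is at least 1, the first is at least 1 unless
  \<open>j = b\<close>, the third unless \<open>i = a\<close>. So the determinant is at least 2 for
  every such pair other than the base.\<close>

lemma labels_det:
  assumes "triangulates E a b" "a < b" "labels E a b w" "a \<le> i" "i < j" "j \<le> b"
  shows "det (w i) (w j) \<ge> 1 \<and> (det (w i) (w j) = 1 \<longleftrightarrow> E i j)"
  using assms
proof (induction arbitrary: i j rule: triangulates_induct)
  case (edge a)
  then have "i = a" "j = Suc a" by auto
  then show ?case using labels_edge[OF \<open>labels E a (Suc a) w\<close>, of i j] edge.hyps by simp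
next
  case (triangle a k b)
  note L = labels_mono[OF \<open>labels E a b w\<close>]
  consider "j \<le> k" | "k \<le> i" | "i < k" "k < j" by linarith
  then show ?case
  proof cases
    case 1
    then show ?thesis using triangle L by auto
  next
    case 2
    then show ?thesis using triangle L by auto
  next
    case 3
    have d: "det (w a) (w k) = 1" "det (w k) (w b) = 1" "det (w a) (w b) = 1"
      using labels_edge[OF \<open>labels E a b w\<close>] triangle.hyps by auto
    have ik: "det (w i) (w k) \<ge> 1" and kj: "det (w k) (w j) \<ge> 1"
      using triangle 3 L by auto
    have ai: "det (w a) (w i) \<ge> (if i = a then 0 else 1)"
      using triangle.IH(1)[of a i] triangle 3 L by auto
    have jb: "det (w j) (w b) \<ge> (if j = b then 0 else 1)"
      using triangle.IH(2)[of j b] triangle 3 L by auto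
    show ?thesis
    proof (cases "i = a \<and> j = b")
      case True
      then show ?thesis using d triangle by auto
    next
      case False
      then have nE: "\<not> E i j"
        using triangulates_across[OF triangle.hyps(6,1,2,3,4)] 3 triangle.prems by blast
      have "det (w i) (w k) * det (w k) (w j) \<ge> 1"
        using ik kj mult_mono[of 1 "det (w i) (w k)" 1 "det (w k) (w j)"] by simp
      moreover have "det (w i) (w k) * det (w j) (w b) \<ge> (if j = b then 0 else 1)"
        using ik jb mult_mono[of 1 "det (w i) (w k)" "if j = b then 0 else 1" "det (w j) (w b)"]
        by (auto split: if_splits)
      moreover have "det (w a) (w i) * det (w k) (w j) \<ge> (if i = a then 0 else 1)"
        using kj ai mult_mono[of "if i = a then 0 else 1" "det (w a) (w i)" 1 "det (w k) (w j)"]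
        by (auto split: if_splits)
      ultimately have "det (w i) (w j) \<ge> 2"
        using det_across_triangle[OF d, of "w i" "w j"] False by (auto split: if_splits)
      then show ?thesis using nE by auto
    qed
  qed
qed

section \<open>Triangle counts and the recurrence of friese numbers\<close>

definition triangles_at :: "(nat \<Rightarrow> nat \<Rightarrow> bool) \<Rightarrow> nat \<Rightarrow> nat \<Rightarrow> nat \<Rightarrow> (nat \<times> nat \<times> nat) set" where
  "triangles_at E a b l = {(x, y, z). a \<le> x \<and> x < y \<and> y < z \<and> z \<le> b \<and>
     E x y \<and> E y z \<and> E x z \<and> (l = x \<or> l = y \<or> l = z)}"

lemma finite_triangles_at: "finite (triangles_at E a b l)"
  by (rule finite_subset[of _ "{..b} \<times> {..b} \<times> {..b}"]) (auto simp: triangles_at_def)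

text \<open>If the longest edge of a triangle passes over \<open>k\<close>, it is the base; the
  third vertex is then \<open>k\<close>, since otherwise a second edge would pass over
  \<open>k\<close>.\<close>

lemma triangles_at_split:
  assumes T: "triangulates E a b" and k: "a < k" "k < b" "E a k" "E k b" "E a b"
  shows "triangles_at E a b l = triangles_at E a k l \<union> triangles_at E k b l \<union>
    (if l \<in> {a, k, b} then {(a, k, b)} else {})" (is "?L = ?R")
proof
  show "?R \<subseteq> ?L" using k by (auto simp: triangles_at_def split: if_splits)
  show "?L \<subseteq> ?R"
  proof
    fix s assume "s \<in> ?L"
    then obtain x y z where s: "s = (x, y, z)" "a \<le> x" "x < y" "y < z" "z \<le> b"
      "E x y" "E y z" "E x z" "l = x \<or> l = y \<or> l = z"
      by (auto simp: triangles_at_def)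
    consider "z \<le> k" | "k \<le> x" | "x < k" "k < z" by linarith
    then show "s \<in> ?R"
    proof cases
      case 3
      note across = triangulates_across[OF T k(1-4)]
      have "x = a" "z = b" using across[of x z] s 3 by auto
      moreover have "\<not> y < k" using across[of y z] s 3 by auto
      moreover have "\<not> k < y" using across[of x y] s 3 by auto
      ultimately show ?thesis using s by auto
    qed (use s in \<open>auto simp: triangles_at_def\<close>)
  qed
qed

lemma card_triangles_at_split:
  assumes T: "triangulates E a b" and k: "a < k" "k < b" "E a k" "E k b" "E a b"
  shows "card (triangles_at E a b l) = card (triangles_at E a k l) + card (triangles_at E k b l) +
    (if l \<in> {a, k, b} then 1 else 0)"
proof -
  have "triangles_at E a k l \<inter> triangles_at E k b l = {}"
    by (auto simp: triangles_at_def)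
  moreover have "(a, k, b) \<notin> triangles_at E a k l \<union> triangles_at E k b l"
    using k by (auto simp: triangles_at_def)
  ultimately show ?thesis
    unfolding triangles_at_split[OF assms]
    by (auto simp: card_Un_disjoint finite_triangles_at)
qed

lemma triangles_at_outside: "l < a \<or> b < l \<or> b \<le> Suc a \<Longrightarrow> triangles_at E a b l = {}"
  by (auto simp: triangles_at_def)

text \<open>Removing the triangle on the base lowers the count by 1 at each of its vertices, and
  \<open>det_across_triangle\<close> lowers the determinant of the two neighbours in the same way.
  The clauses for the end vertices feed the induction at the apex, which is an end of both
  halves.\<close>

lemma card_triangles_at:
  assumes "triangulates E a b" "a < b" "labels E a b w"
  shows "int (card (triangles_at E a b a)) = det (w (Suc a)) (w b) \<and>
    int (card (triangles_at E a b b)) = det (w a) (w (b - 1)) \<and>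
    (\<forall>l. a < l \<and> l < b \<longrightarrow> int (card (triangles_at E a b l)) = det (w (l - 1)) (w (Suc l)))"
  using assms
proof (induction rule: triangulates_induct)
  case (edge a)
  then show ?case by (auto simp: triangles_at_outside)
next
  case (triangle a k b)
  note L = labels_mono[OF \<open>labels E a b w\<close>]
  have d: "det (w a) (w k) = 1" "det (w k) (w b) = 1" "det (w a) (w b) = 1"
    using labels_edge[OF \<open>labels E a b w\<close>] triangle.hyps by auto
  have side: "det (w i) (w (Suc i)) = 1" if "a \<le> i" "i < b" for i
    using labels_edge[OF \<open>labels E a b w\<close>] triangulates_side[OF \<open>triangulates E a b\<close>] that by simp
  have IH1: "int (card (triangles_at E a k a)) = det (w (Suc a)) (w k)"
    "int (card (triangles_at E a k k)) = det (w a) (w (k - 1))"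
    "\<And>l. a < l \<Longrightarrow> l < k \<Longrightarrow> int (card (triangles_at E a k l)) = det (w (l - 1)) (w (Suc l))"
    using triangle L by auto
  have IH2: "int (card (triangles_at E k b k)) = det (w (Suc k)) (w b)"
    "int (card (triangles_at E k b b)) = det (w k) (w (b - 1))"
    "\<And>l. k < l \<Longrightarrow> l < b \<Longrightarrow> int (card (triangles_at E k b l)) = det (w (l - 1)) (w (Suc l))"
    using triangle L by auto
  note split = card_triangles_at_split[OF triangle.hyps(6,1-5)]
  note across = det_across_triangle[OF d]
  have out: "triangles_at E k b l = {}" if "l < k" for l
    using that by (simp add: triangles_at_outside)
  have out': "triangles_at E a k l = {}" if "k < l" for l
    using that by (simp add: triangles_at_outside)
  show ?case
  proof (intro conjI allI impI)
    show "int (card (triangles_at E a b a)) = det (w (Suc a)) (w b)"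
      using split[of a] IH1(1) out[of a] across[of "w (Suc a)" "w b"] side[of a] triangle.hyps d
      by (simp add: det_swap[of "w (Suc a)" "w k"])
    show "int (card (triangles_at E a b b)) = det (w a) (w (b - 1))"
      using split[of b] IH2(2) out'[of b] across[of "w a" "w (b - 1)"] side[of "b - 1"] triangle.hyps d
      by simp
  next
    fix l assume l: "a < l \<and> l < b"
    consider "l < k" | "l = k" | "k < l" by linarith
    then show "int (card (triangles_at E a b l)) = det (w (l - 1)) (w (Suc l))"
    proof cases
      case 1
      then show ?thesis using split[of l] IH1(3)[of l] out[of l] l triangle.hyps by simp
    next
      case 2
      have "det (w (k - 1)) (w k) = 1" "det (w k) (w (Suc k)) = 1"
        using side[of "k - 1"] side[of k] triangle.hyps by auto
      then show ?thesis
        using split[of k] IH1(2) IH2(1) across[of "w (k - 1)" "w (Suc k)"] 2 by simp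
    next
      case 3
      then show ?thesis using split[of l] IH2(3)[of l] out'[of l] l triangle.hyps by simp
    qed
  qed
qed

text \<open>With sides of determinant 1, the Pluecker relation is the three-term recurrence. Since
  \<open>k + d \<le> n\<close>, every coefficient met has an index strictly between 0 and
  \<open>n\<close>, where reduction modulo \<open>Suc n\<close> is the identity.\<close>

lemma friese_seq_det:
  assumes "\<And>m. 0 < m \<Longrightarrow> m < n \<Longrightarrow> c m = det (w (m - 1)) (w (Suc m))"
    and side: "\<And>i. i < n \<Longrightarrow> det (w i) (w (Suc i)) = 1"
    and "k + d \<le> n"
  shows "friese_seq c (Suc n) k d = det (w k) (w (k + d))"
  using assms(3)
proof (induction d rule: induct_nat_012)
  case (ge2 d)
  then have "friese_seq c (Suc n) k (Suc (Suc d)) =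
      det (w (k + d)) (w (Suc (Suc (k + d)))) * det (w k) (w (Suc (k + d))) - det (w k) (w (k + d))"
    using assms(1)[of "Suc (k + d)"] by simp
  moreover have "det (w (k + d)) (w (Suc (k + d))) = 1"
    "det (w (Suc (k + d))) (w (Suc (Suc (k + d)))) = 1"
    using side ge2 by auto
  ultimately show ?case
    using pluecker[of "w k" "w (Suc (k + d))" "w (k + d)" "w (Suc (Suc (k + d)))"]
    by (simp add: mult.commute)
qed (use side in auto)

section \<open>Polygons with unimodular vertex labels\<close>

lemma unimodular_apex:
  assumes pos: "\<And>i j. a \<le> i \<Longrightarrow> i < j \<Longrightarrow> j \<le> b \<Longrightarrow> det (w i) (w j) \<ge> 1"
    and side: "\<And>i. a \<le> i \<Longrightarrow> i < b \<Longrightarrow> det (w i) (w (Suc i)) = 1"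
    and base: "det (w a) (w b) = 1" and "Suc a < b"
  shows "\<exists>k. a < k \<and> k < b \<and> det (w a) (w k) = 1 \<and> det (w k) (w b) = 1"
proof -
  \<comment> \<open>\<open>x i\<close>, \<open>y i\<close> are the coordinates of \<open>w i\<close> in the basis \<open>w a\<close>, \<open>w b\<close>;
    the apex is the last vertex before the slope \<open>y / x\<close> exceeds 1.\<close>
  define x y where "x i = det (w i) (w b)" and "y i = det (w a) (w i)" for i
  let ?S = "{k. a < k \<and> k < b \<and> y k \<le> x k}"
  have ne: "Suc a \<in> ?S"
    using side[of a] pos[of "Suc a" b] assms(4) by (auto simp: x_def y_def)
  define k where "k = Max ?S"
  have "k \<in> ?S" unfolding k_def using ne by (intro Max_in) auto
  then have k: "a < k" "k < b" "y k \<le> x k" by auto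
  have mx: "i \<le> k" if "a < i" "i < b" "y i \<le> x i" for i
    unfolding k_def using that by (intro Max_ge) auto
  have yk: "y k \<ge> 1" using pos[of a k] k by (auto simp: y_def)
  have "x k = 1 \<and> y k = 1"
  proof (cases "Suc k = b")
    case True
    then have "x k = 1" using side[of k] k by (auto simp: x_def)
    then show ?thesis using k yk by auto
  next
    case False
    then have kb: "Suc k < b" using k by auto
    have less: "x (Suc k) < y (Suc k)" using mx[of "Suc k"] kb k by force
    have x1: "x (Suc k) \<ge> 1" using pos[of "Suc k" b] kb k by (auto simp: x_def)
    \<comment> \<open>The slope passes 1 between \<open>k\<close> and \<open>Suc k\<close>:
      \<open>d\<close> is the deficit before, \<open>e\<close> the excess after. The unit
      determinant of these neighbours becomes a sum of two nonnegative integers equal to 1, the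
      first of them positive.\<close>
    define d e where "d = x k - y k" and "e = y (Suc k) - x (Suc k)"
    have "x k * y (Suc k) - y k * x (Suc k) = 1"
      using pluecker[of "w a" "w b" "w k" "w (Suc k)"] side[of k] base k
      by (simp add: x_def y_def det_swap[of "w b" "w (Suc k)"] mult.commute)
    then have eq: "y k * e + d * y (Suc k) = 1"
      by (simp add: d_def e_def algebra_simps)
    have "y k * e \<ge> y k * 1" using yk less by (intro mult_left_mono) (auto simp: e_def)
    moreover have "d * y (Suc k) \<ge> d * 1" using k x1 less by (intro mult_left_mono) (auto simp: d_def)
    moreover have "d \<ge> 0" using k by (simp add: d_def)
    ultimately have "y k = 1" "d = 0" using eq yk by linarith+
    then show ?thesis by (simp add: d_def)
  qed
  then show ?thesis using k by (auto simp: x_def y_def)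
qed

text \<open>Induction along \<open>unimodular_apex\<close>. A pair separated by the apex is not the
  base, whose determinant is 1, so one of the other two sides of the triangle crosses it.\<close>

lemma unimodular_crossed:
  assumes "\<And>i j. a \<le> i \<Longrightarrow> i < j \<Longrightarrow> j \<le> b \<Longrightarrow> det (w i) (w j) \<ge> 1"
    and "\<And>i. a \<le> i \<Longrightarrow> i < b \<Longrightarrow> det (w i) (w (Suc i)) = 1"
    and "det (w a) (w b) = 1"
    and "a \<le> i" "i < j" "j \<le> b" "det (w i) (w j) \<noteq> 1"
  shows "\<exists>k l. a \<le> k \<and> k < l \<and> l \<le> b \<and> det (w k) (w l) = 1 \<and>
    (i < k \<and> k < j \<and> j < l \<or> k < i \<and> i < l \<and> l < j)"
  using assms
proof (induction "b - a" arbitrary: a b rule: less_induct)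
  case less
  have "Suc a < b"
    using less.prems by (metis Suc_lessI le_antisym le_less_trans less_Suc_eq_le less_le_trans not_less_eq_eq)
  then obtain k where k: "a < k" "k < b" "det (w a) (w k) = 1" "det (w k) (w b) = 1"
    using unimodular_apex[of a b w] less.prems(1-3) by blast
  consider "j \<le> k" | "k \<le> i" | "i < k" "k < j" by linarith
  then show ?case
  proof cases
    case 1
    have "\<exists>k' l. a \<le> k' \<and> k' < l \<and> l \<le> k \<and> det (w k') (w l) = 1 \<and>
      (i < k' \<and> k' < j \<and> j < l \<or> k' < i \<and> i < l \<and> l < j)"
      by (rule less.hyps) (use less.prems k 1 in auto)
    then show ?thesis using k by (meson less_imp_le order_trans)
  next
    case 2
    have "\<exists>k' l. k \<le> k' \<and> k' < l \<and> l \<le> b \<and> det (w k') (w l) = 1 \<and>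
      (i < k' \<and> k' < j \<and> j < l \<or> k' < i \<and> i < l \<and> l < j)"
      by (rule less.hyps) (use less.prems k 2 in auto)
    then show ?thesis using k by (meson less_imp_le order_trans)
  next
    case 3
    have "i = a \<longrightarrow> j \<noteq> b" using less.prems by auto
    then consider "a < i" | "j < b" using less.prems by linarith
    then show ?thesis
    proof cases
      case 1
      then show ?thesis using k 3 by (intro exI[of _ a] exI[of _ k]) auto
    next
      case 2
      then show ?thesis using k 3 by (intro exI[of _ k] exI[of _ b]) auto
    qed
  qed
qed

section \<open>Arcs and polygons of the strip\<close>

text \<open>Cutting the boundary of the strip at its right end makes the vertices a linear order, in which
  all cases of crossing become interleaving of endpoints.\<close>
fun precedes :: "vert \<Rightarrow> vert \<Rightarrow> bool" (infix "\<prec>" 50) where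
  "Up a \<prec> Up b \<longleftrightarrow> a < b"
| "Up a \<prec> Lo b \<longleftrightarrow> True"
| "Lo a \<prec> Up b \<longleftrightarrow> False"
| "Lo a \<prec> Lo b \<longleftrightarrow> a < b"

lemma precedes_irrefl [simp]: "\<not> x \<prec> x"
  by (cases x) auto

lemma precedes_asym: "x \<prec> y \<Longrightarrow> \<not> y \<prec> x"
  by (cases x; cases y) auto

lemma precedes_trans: "x \<prec> y \<Longrightarrow> y \<prec> z \<Longrightarrow> x \<prec> z"
  by (cases x; cases y; cases z) auto

fun src :: "arc \<Rightarrow> vert" where
  "src (Conn p q) = Up p"
| "src (UArc a b) = Up a"
| "src (LArc a b) = Lo a"

fun tgt :: "arc \<Rightarrow> vert" where
  "tgt (Conn p q) = Lo q"
| "tgt (UArc a b) = Up b"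
| "tgt (LArc a b) = Lo b"

text \<open>The boundary segments of the strip: exactly the pairs in increasing order that are not
  the ends of an arc.\<close>

fun consecutive :: "vert \<Rightarrow> vert \<Rightarrow> bool" where
  "consecutive (Up a) (Up b) \<longleftrightarrow> b = a + 1"
| "consecutive (Lo a) (Lo b) \<longleftrightarrow> b = a + 1"
| "consecutive _ _ \<longleftrightarrow> False"

lemma endpoints_src_tgt: "endpoints z = {src z, tgt z}"
  by (cases z) auto

lemma arc_eqI: "src y = src z \<Longrightarrow> tgt y = tgt z \<Longrightarrow> y = z"
  by (cases y; cases z) auto

lemma src_precedes_tgt: "is_arc z \<Longrightarrow> src z \<prec> tgt z"
  by (cases z) auto

lemma not_consecutive_src_tgt: "is_arc z \<Longrightarrow> \<not> consecutive (src z) (tgt z)"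
  by (cases z) auto

lemma consecutive_precedes: "consecutive x y \<Longrightarrow> x \<prec> y"
  by (cases "(x, y)" rule: consecutive.cases) auto

lemma consecutive_no_between: "consecutive x y \<Longrightarrow> x \<prec> z \<Longrightarrow> z \<prec> y \<Longrightarrow> False"
  by (cases x; cases y; cases z) auto

lemma arc_between:
  assumes "x \<prec> y" "\<not> consecutive x y"
  obtains z where "is_arc z" "src z = x" "tgt z = y"
proof (cases x; cases y)
  fix a b assume "x = Up a" "y = Up b"
  then show thesis using assms that[of "UArc a b"] by auto
next
  fix a b assume "x = Up a" "y = Lo b"
  then show thesis using assms that[of "Conn a b"] by auto
next
  fix a b assume "x = Lo a" "y = Lo b"
  then show thesis using assms that[of "LArc a b"] by auto
next
  fix a b assume "x = Lo a" "y = Up b"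
  then show thesis using assms by auto
qed

lemma crosses_iff_interleaved:
  assumes "is_arc y" "is_arc z"
  shows "crosses y z \<longleftrightarrow>
    src y \<prec> src z \<and> src z \<prec> tgt y \<and> tgt y \<prec> tgt z \<or>
    src z \<prec> src y \<and> src y \<prec> tgt z \<and> tgt z \<prec> tgt y"
  using assms by (cases y; cases z) (auto simp: zero_less_mult_iff)

text \<open>Boundary segments join the arcs, so that sides and diagonals of polygons fall under a
  single relation, directed by \<open>\<prec>\<close>.\<close>

definition edge :: "arc set \<Rightarrow> vert \<Rightarrow> vert \<Rightarrow> bool" where
  "edge T x y \<longleftrightarrow> consecutive x y \<or> (\<exists>z\<in>T. src z = x \<and> tgt z = y)"

lemma edge_src_tgt: "is_arc z \<Longrightarrow> edge T (src z) (tgt z) \<longleftrightarrow> z \<in> T"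
  unfolding edge_def using not_consecutive_src_tgt arc_eqI by metis

lemma edge_precedes: "is_triangulation T \<Longrightarrow> edge T x y \<Longrightarrow> x \<prec> y"
  unfolding edge_def is_triangulation_def using src_precedes_tgt consecutive_precedes by metis

lemma edge_noncrossing:
  assumes T: "is_triangulation T" and "edge T x y" "edge T u v" "x \<prec> u" "u \<prec> y" "y \<prec> v"
  shows False
proof -
  have "\<not> consecutive x y" "\<not> consecutive u v"
    using consecutive_no_between assms by blast+
  then obtain y' z where yz: "y' \<in> T" "src y' = x" "tgt y' = y" "z \<in> T" "src z = u" "tgt z = v"
    using assms(2,3) unfolding edge_def by blast
  then have "is_arc y'" "is_arc z" "y' \<noteq> z"
    using T assms(4) by (auto simp: is_triangulation_def)
  then have "crosses y' z" using crosses_iff_interleaved yz assms by simp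
  then show False using T yz \<open>y' \<noteq> z\<close> by (auto simp: is_triangulation_def)
qed

lemma edge_crossed:
  assumes T: "is_triangulation T" and "x \<prec> y" "\<not> edge T x y"
  obtains u v where "edge T u v" "x \<prec> u \<and> u \<prec> y \<and> y \<prec> v \<or> u \<prec> x \<and> x \<prec> v \<and> v \<prec> y"
proof -
  have "\<not> consecutive x y" using assms by (auto simp: edge_def)
  then obtain z where z: "is_arc z" "src z = x" "tgt z = y"
    using arc_between assms(2) by blast
  then have "z \<notin> T" using assms(3) edge_src_tgt by blast
  then obtain z' where z': "z' \<in> T" "crosses z z'" "is_arc z'"
    using T z unfolding is_triangulation_def by blast
  then show thesis
    using that[of "src z'" "tgt z'"] crosses_iff_interleaved[of z z'] z edge_src_tgt by auto
qed

text \<open>Only the numbering of the vertices, without a triangulation: the passage from tilings to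
  triangulations uses such polygons before a triangulation is available.\<close>

locale strip_rectangle =
  fixes p q r s :: int
  assumes pr: "p < r" and sq: "s < q"
begin

definition "vs = strip_poly p r s q"
definition "n = nat (r - p) + nat (q - s) + 1"

lemma length_vs: "length vs = Suc n"
  using pr sq by (simp add: vs_def strip_poly_def n_def)

lemma Up_in_vs [simp]: "Up a \<in> set vs \<longleftrightarrow> p \<le> a \<and> a \<le> r"
  and Lo_in_vs [simp]: "Lo b \<in> set vs \<longleftrightarrow> s \<le> b \<and> b \<le> q"
  by (auto simp: vs_def strip_poly_def)

lemma nth_Up: "p \<le> a \<Longrightarrow> a \<le> r \<Longrightarrow> vs ! nat (a - p) = Up a"
  using pr by (simp add: vs_def strip_poly_def nth_append)

lemma nth_Lo: "s \<le> b \<Longrightarrow> b \<le> q \<Longrightarrow> vs ! (nat (r - p) + 1 + nat (b - s)) = Lo b"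
proof -
  assume "s \<le> b" "b \<le> q"
  moreover have "length (map Up [p..r]) = nat (r - p) + 1" using pr by simp
  ultimately show ?thesis
    unfolding vs_def strip_poly_def
    using nth_append_length_plus[of "map Up [p..r]" "map Lo [s..q]" "nat (b - s)"] by simp
qed

lemma index_cases [consumes 1, case_names Up Lo]:
  assumes "i \<le> n"
  obtains a where "p \<le> a" "a \<le> r" "i = nat (a - p)" "vs ! i = Up a"
  | b where "s \<le> b" "b \<le> q" "i = nat (r - p) + 1 + nat (b - s)" "vs ! i = Lo b"
proof (cases "i \<le> nat (r - p)")
  case True
  then have "p \<le> p + int i" "p + int i \<le> r" "i = nat (p + int i - p)" using pr by auto
  then show ?thesis using that(1)[of "p + int i"] nth_Up[of "p + int i"] by simp
next
  case False
  define b where "b = s + int (i - nat (r - p) - 1)"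
  have "s \<le> b" "b \<le> q" "i = nat (r - p) + 1 + nat (b - s)"
    using False assms sq pr unfolding b_def n_def by auto
  then show ?thesis using that(2)[of b] nth_Lo[of b] by simp
qed

lemma nth_precedes: "i < j \<Longrightarrow> j \<le> n \<Longrightarrow> vs ! i \<prec> vs ! j"
proof -
  assume "i < j" "j \<le> n"
  then have "i \<le> n" by simp
  show ?thesis
    by (rule index_cases[OF \<open>i \<le> n\<close>]; rule index_cases[OF \<open>j \<le> n\<close>])
      (use \<open>i < j\<close> pr sq in auto)
qed

lemma nth_precedes_iff: "i \<le> n \<Longrightarrow> j \<le> n \<Longrightarrow> vs ! i \<prec> vs ! j \<longleftrightarrow> i < j"
  using nth_precedes precedes_asym by (metis linorder_neqE_nat precedes_irrefl)

lemma nth_eq_iff: "i \<le> n \<Longrightarrow> j \<le> n \<Longrightarrow> vs ! i = vs ! j \<longleftrightarrow> i = j"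
  using nth_precedes by (metis linorder_neqE_nat precedes_irrefl)

lemma nth_0: "vs ! 0 = Up p" and nth_n: "vs ! n = Lo q"
  using nth_Up[of p] nth_Lo[of q] pr sq by (simp_all add: n_def)

lemma ex_index: "x \<in> set vs \<Longrightarrow> \<exists>i\<le>n. vs ! i = x"
  using length_vs by (metis in_set_conv_nth less_Suc_eq_le)

lemma nth_Suc:
  assumes "i < n"
  shows "consecutive (vs ! i) (vs ! Suc i) \<or> vs ! i = Up r \<and> vs ! Suc i = Lo s"
proof -
  have "i \<le> n" "Suc i \<le> n" using assms by auto
  show ?thesis
    by (rule index_cases[OF \<open>i \<le> n\<close>]; rule index_cases[OF \<open>Suc i \<le> n\<close>]) (use pr sq in auto)
qed

end

section \<open>Polygons cut out by two connecting arcs of a triangulation\<close>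

locale strip_polygon = strip_rectangle +
  fixes T :: "arc set"
  assumes T: "is_triangulation T" and pq: "Conn p q \<in> T" and rs: "Conn r s \<in> T"
begin

text \<open>An edge that crosses a chord of the polygon and leaves the polygon would cross one of
  the bounding arcs \<open>Conn p q\<close> and \<open>Conn r s\<close>.\<close>

lemma edge_inside:
  assumes "edge T u v" "x \<in> set vs" "y \<in> set vs"
    and "x \<prec> u \<and> u \<prec> y \<and> y \<prec> v \<or> u \<prec> x \<and> x \<prec> v \<and> v \<prec> y"
  shows "u \<in> set vs" "v \<in> set vs"
proof -
  have e: "edge T (Up p) (Lo q)" "edge T (Up r) (Lo s)"
    using pq rs by (auto simp: edge_def intro: bexI[of _ "Conn p q"] bexI[of _ "Conn r s"])
  have nc: "\<not> (Up p \<prec> u \<and> u \<prec> Lo q \<and> Lo q \<prec> v)" "\<not> (u \<prec> Up p \<and> Up p \<prec> v \<and> v \<prec> Lo q)"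
    "\<not> (Up r \<prec> u \<and> u \<prec> Lo s \<and> Lo s \<prec> v)" "\<not> (u \<prec> Up r \<and> Up r \<prec> v \<and> v \<prec> Lo s)"
    using edge_noncrossing[OF T] assms(1) e by blast+
  have "u \<prec> v" using edge_precedes[OF T assms(1)] .
  then have "u \<in> set vs \<and> v \<in> set vs"
  proof (cases u; cases v)
    fix a b assume [simp]: "u = Up a" "v = Up b" and "u \<prec> v"
    then show ?thesis using nc assms(2-4) pr by (cases x; cases y) auto
  next
    fix a b assume [simp]: "u = Up a" "v = Lo b" and "u \<prec> v"
    then show ?thesis using nc assms(2-4) pr sq by (cases x; cases y) auto
  next
    fix a b assume [simp]: "u = Lo a" "v = Lo b" and "u \<prec> v"
    then show ?thesis using nc assms(2-4) sq by (cases x; cases y) auto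
  qed auto
  then show "u \<in> set vs" "v \<in> set vs" by auto
qed

abbreviation "E i j \<equiv> edge T (vs ! i) (vs ! j)"

text \<open>By \<open>edge_inside\<close>, whatever crosses a chord of the polygon lies in the
  polygon, so maximality in the strip restricts to it.\<close>

lemma triangulates_polygon: "triangulates E 0 n"
  unfolding triangulates_def
proof (intro allI impI iffI notI, goal_cases)
  case (1 i j)
  then obtain k l where "k < l" "l \<le> n" "E k l"
    "i < k \<and> k < j \<and> j < l \<or> k < i \<and> i < l \<and> l < j" by blast
  then show False
    using edge_noncrossing[OF T, of "vs ! i" "vs ! j" "vs ! k" "vs ! l"]
      edge_noncrossing[OF T, of "vs ! k" "vs ! l" "vs ! i" "vs ! j"] 1 nth_precedes by auto
next
  case (2 i j)
  show ?case
  proof (rule ccontr)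
    assume "\<not> E i j"
    then obtain u v where uv: "edge T u v"
      "vs ! i \<prec> u \<and> u \<prec> vs ! j \<and> vs ! j \<prec> v \<or> u \<prec> vs ! i \<and> vs ! i \<prec> v \<and> v \<prec> vs ! j"
      using edge_crossed[OF T] nth_precedes 2(1) by metis
    have "vs ! i \<in> set vs" "vs ! j \<in> set vs" using 2(1) length_vs by auto
    then obtain k l where kl: "k \<le> n" "l \<le> n" "u = vs ! k" "v = vs ! l"
      using edge_inside[OF uv(1) _ _ uv(2)] ex_index by metis
    then have "k < l" using uv edge_precedes[OF T] nth_precedes_iff by auto
    then show False using 2 uv kl nth_precedes_iff by auto
  qed
qed

lemma side_edge:
  assumes "{x, y} \<in> poly_sides vs" "x \<prec> y"
  shows "edge T x y"
proof -
  obtain i where i: "i \<le> n" "{x, y} = {vs ! i, vs ! ((i + 1) mod Suc n)}"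
    using assms(1) unfolding poly_sides_def length_vs by (auto simp: less_Suc_eq_le)
  show ?thesis
  proof (cases "i = n")
    \<comment> \<open>The closing side is listed from the last vertex to the first, against the
      order \<open>\<prec>\<close>.\<close>
    case True
    then have "{x, y} = {vs ! n, vs ! 0}" using i by simp
    then have "x = vs ! 0 \<and> y = vs ! n"
      using assms(2) nth_precedes_iff[of n 0] by (auto simp: doubleton_eq_iff)
    then show ?thesis using triangulates_edge[OF triangulates_polygon] by (simp add: n_def)
  next
    case False
    then have "i < n" "{x, y} = {vs ! i, vs ! Suc i}" using i by auto
    then have "x = vs ! i \<and> y = vs ! Suc i"
      using assms(2) nth_precedes_iff[of "Suc i" i] by (auto simp: doubleton_eq_iff)
    then show ?thesis using triangulates_side[OF triangulates_polygon] \<open>i < n\<close> by simp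
  qed
qed

lemma successor_side: "i < n \<Longrightarrow> {vs ! i, vs ! Suc i} \<in> poly_sides vs"
  unfolding poly_sides_def using length_vs by (auto intro!: exI[of _ i])

lemma consecutive_side:
  assumes "consecutive x y" "x \<in> set vs" "y \<in> set vs"
  shows "{x, y} \<in> poly_sides vs"
proof (cases x; cases y)
  fix a b assume "x = Up a" "y = Up b"
  then have a: "p \<le> a" "b \<le> r" "b = a + 1" using assms by auto
  then have "vs ! nat (a - p) = Up a" "vs ! Suc (nat (a - p)) = Up b"
    using nth_Up[of a] nth_Up[of b] by (simp_all add: Suc_nat_eq_nat_zadd1 algebra_simps)
  moreover have "nat (a - p) < n" using a sq by (simp add: n_def)
  ultimately show ?thesis using successor_side \<open>x = Up a\<close> \<open>y = Up b\<close> by metis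
next
  fix a b assume "x = Lo a" "y = Lo b"
  then have a: "s \<le> a" "b \<le> q" "b = a + 1" using assms by auto
  let ?k = "nat (r - p) + 1 + nat (a - s)"
  have "nat (b - s) = Suc (nat (a - s))" using a by auto
  then have "vs ! ?k = Lo a" "vs ! Suc ?k = Lo b"
    using nth_Lo[of a] nth_Lo[of b] a by simp_all
  moreover have "?k < n" using a by (simp add: n_def)
  ultimately show ?thesis using successor_side \<open>x = Lo a\<close> \<open>y = Lo b\<close> by metis
qed (use assms in auto)

section \<open>Friese values of strip polygons as determinants\<close>

abbreviation "D \<equiv> restrict_triang T vs"

lemma poly_adj_sym: "poly_adj vs D x y \<longleftrightarrow> poly_adj vs D y x"
  unfolding poly_adj_def by (auto simp: insert_commute)

text \<open>The sides removed in \<open>restrict_triang\<close> come back through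
  \<open>poly_sides\<close>. Two of them are the bounding arcs, the others are boundary
  segments.\<close>

lemma poly_adj_iff_edge:
  assumes "x \<in> set vs" "y \<in> set vs" "x \<prec> y"
  shows "poly_adj vs D x y \<longleftrightarrow> edge T x y"
proof
  assume "poly_adj vs D x y"
  then consider "{x, y} \<in> poly_sides vs" | z where "z \<in> T" "{x, y} = endpoints z"
    unfolding poly_adj_def restrict_triang_def by auto
  then show "edge T x y"
  proof cases
    case 1
    then show ?thesis using side_edge assms by blast
  next
    case 2
    then have "src z \<prec> tgt z" using T src_precedes_tgt by (auto simp: is_triangulation_def)
    then have "x = src z \<and> y = tgt z"
      using 2(2) assms(3) precedes_asym by (auto simp: endpoints_src_tgt doubleton_eq_iff)
    then show ?thesis using 2(1) by (auto simp: edge_def)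
  qed
next
  assume "edge T x y"
  then consider "consecutive x y" | z where "z \<in> T" "{x, y} = endpoints z"
    unfolding edge_def endpoints_src_tgt by auto
  then have "{x, y} \<in> poly_sides vs \<or> {x, y} \<in> D"
  proof cases
    case 1
    then show ?thesis using consecutive_side assms by blast
  next
    case 2
    moreover have "{x, y} \<subseteq> set vs" using assms by simp
    ultimately show ?thesis unfolding restrict_triang_def by blast
  qed
  moreover have "x \<noteq> y" using assms(3) by auto
  ultimately show "poly_adj vs D x y" using assms by (auto simp: poly_adj_def)
qed

lemma sorted_triple:
  fixes i j k :: nat
  assumes "i \<noteq> j" "j \<noteq> k" "i \<noteq> k"
  obtains x y z where "x < y" "y < z" "{x, y, z} = {i, j, k}"
proof -
  have "i < j \<and> j < k \<or> i < k \<and> k < j \<or> j < i \<and> i < k \<or> j < k \<and> k < i \<or> k < i \<and> i < j \<or> k < j \<and> j < i"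
    using assms by linarith
  then show thesis
    using that[of i j k] that[of i k j] that[of j i k] that[of j k i] that[of k i j] that[of k j i]
    by (auto simp: insert_commute)
qed

lemma sorted_triple_unique:
  fixes x y z :: nat
  assumes "{x, y, z} = {x', y', z'}" "x < y" "y < z" "x' < y'" "y' < z'"
  shows "x = x' \<and> y = y' \<and> z = z'"
proof -
  have "sorted_list_of_set {x, y, z} = [x, y, z]" "sorted_list_of_set {x', y', z'} = [x', y', z']"
    using assms(2-5) by auto
  then have "[x, y, z] = [x', y', z']" using assms(1) by metis
  then show ?thesis by simp
qed

text \<open>Sending an increasing triple of indices to its set of vertices is a bijection onto the
  triangles at the vertex; the ordering makes it injective.\<close>

lemma tri_count_eq_card:
  assumes "l \<le> n"
  shows "tri_count vs D l = int (card (triangles_at E 0 n l))"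
proof -
  let ?f = "\<lambda>(x, y, z). {vs ! x, vs ! y, vs ! z}"
  have adj: "poly_adj vs D (vs ! i) (vs ! j) \<longleftrightarrow> E i j" if "i < j" "j \<le> n" for i j
    using that nth_precedes[of i j] length_vs by (intro poly_adj_iff_edge) auto
  have inj: "inj_on (\<lambda>i. vs ! i) {..n}" using nth_eq_iff by (auto intro: inj_onI)
  have inj': "inj_on ?f (triangles_at E 0 n l)"
  proof (rule inj_onI)
    fix s s' assume *: "s \<in> triangles_at E 0 n l" "s' \<in> triangles_at E 0 n l" "?f s = ?f s'"
    obtain x y z x' y' z' where s: "s = (x, y, z)" "s' = (x', y', z')" by (metis prod_cases3)
    then have o: "x < y" "y < z" "z \<le> n" "x' < y'" "y' < z'" "z' \<le> n"
      using * by (auto simp: triangles_at_def)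
    have "(\<lambda>i. vs ! i) ` {x, y, z} = (\<lambda>i. vs ! i) ` {x', y', z'}" using * s by simp
    then have "{x, y, z} = {x', y', z'}"
      using inj_on_image_eq_iff[OF inj, of "{x, y, z}" "{x', y', z'}"] o by auto
    from sorted_triple_unique[OF this o(1,2,4,5)] show "s = s'" using s by simp
  qed
  have "?f ` triangles_at E 0 n l = {S \<in> poly_triangles vs D. vs ! l \<in> S}"
  proof (intro equalityI subsetI)
    fix S assume "S \<in> ?f ` triangles_at E 0 n l"
    then obtain x y z where "S = {vs ! x, vs ! y, vs ! z}" "x < y" "y < z" "z \<le> n"
      "E x y" "E y z" "E x z" "l = x \<or> l = y \<or> l = z"
      by (auto simp: triangles_at_def)
    moreover from this have "poly_adj vs D (vs ! x) (vs ! y)" "poly_adj vs D (vs ! y) (vs ! z)"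
      "poly_adj vs D (vs ! x) (vs ! z)"
      by (simp_all add: adj)
    ultimately show "S \<in> {S \<in> poly_triangles vs D. vs ! l \<in> S}"
      unfolding poly_triangles_def by blast
  next
    fix S assume "S \<in> {S \<in> poly_triangles vs D. vs ! l \<in> S}"
    then obtain u v w where S: "S = {u, v, w}" "vs ! l \<in> S"
      "poly_adj vs D u v" "poly_adj vs D v w" "poly_adj vs D u w"
      by (auto simp: poly_triangles_def)
    then have pw: "poly_adj vs D g h" if "g \<in> S" "h \<in> S" "g \<noteq> h" for g h
      using that poly_adj_sym by blast
    have m: "u \<in> set vs" "v \<in> set vs" "w \<in> set vs" "u \<noteq> v" "v \<noteq> w" "u \<noteq> w"
      using S by (auto simp: poly_adj_def)
    then obtain i j k where ijk: "i \<le> n" "j \<le> n" "k \<le> n" "vs ! i = u" "vs ! j = v" "vs ! k = w"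
      using ex_index by meson
    then have "i \<noteq> j" "j \<noteq> k" "i \<noteq> k" using m by auto
    then obtain x y z where xyz: "x < y" "y < z" "{x, y, z} = {i, j, k}" by (rule sorted_triple)
    have "x \<in> {i, j, k}" "y \<in> {i, j, k}" "z \<in> {i, j, k}" using xyz(3) by blast+
    then have le: "x \<le> n" "y \<le> n" "z \<le> n" using ijk by auto
    have "(\<lambda>i. vs ! i) ` {x, y, z} = (\<lambda>i. vs ! i) ` {i, j, k}" using xyz(3) by simp
    then have S': "S = {vs ! x, vs ! y, vs ! z}" using S(1) ijk by simp
    then have "E x y" "E y z" "E x z"
      using pw[of "vs ! x" "vs ! y"] pw[of "vs ! y" "vs ! z"] pw[of "vs ! x" "vs ! z"]
        xyz le adj[of x y] adj[of y z] adj[of x z] by (auto simp: nth_eq_iff)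
    moreover have "l = x \<or> l = y \<or> l = z" using S(2) S' le assms by (auto simp: nth_eq_iff)
    ultimately have "(x, y, z) \<in> triangles_at E 0 n l"
      using xyz le by (simp add: triangles_at_def)
    then show "S \<in> ?f ` triangles_at E 0 n l" using S' by (intro image_eqI) auto
  qed
  from this[symmetric] show ?thesis
    by (simp only: tri_count_def card_image[OF inj'])
qed

lemma vidx_nth: "i \<le> n \<Longrightarrow> vidx vs (vs ! i) = i"
  unfolding vidx_def length_vs by (rule the_equality) (auto simp: nth_eq_iff less_Suc_eq_le)

text \<open>The labelling is arbitrary as long as edges have determinant 1; this freedom later
  allows the labelling of a larger polygon to be used.\<close>

lemma friese_val_eq_det:
  assumes w: "\<And>x y. x \<in> set vs \<Longrightarrow> y \<in> set vs \<Longrightarrow> edge T x y \<Longrightarrow> det (w x) (w y) = 1"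
    and "x \<in> set vs" "y \<in> set vs" "x \<prec> y"
  shows "friese_val vs D x y = det (w x) (w y)"
proof -
  obtain k l where k: "k \<le> n" "vs ! k = x" and l: "l \<le> n" "vs ! l = y"
    using ex_index assms by meson
  then have kl: "k < l" using assms(4) nth_precedes_iff by auto
  let ?w = "\<lambda>i. w (vs ! i)"
  have lab: "labels E 0 n ?w" unfolding labels_def using w length_vs by auto
  have n: "0 < n" by (simp add: n_def)
  have "tri_count vs D m = det (?w (m - 1)) (?w (Suc m))" if "0 < m" "m < n" for m
    using tri_count_eq_card[of m] card_triangles_at[OF triangulates_polygon n lab] that by simp
  moreover have "det (?w i) (?w (Suc i)) = 1" if "i < n" for i
    using labels_edge[OF lab] triangulates_side[OF triangulates_polygon] that by simp
  ultimately have "friese_seq (tri_count vs D) (Suc n) k (l - k) = det (?w k) (?w (k + (l - k)))"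
    using kl l by (intro friese_seq_det) auto
  \<comment> \<open>As \<open>k < l\<close>, the friese sequence runs from \<open>k\<close> to
    \<open>l\<close> without passing the closing side.\<close>
  moreover have "(l + Suc n - k) mod Suc n = l - k"
  proof -
    have "l + Suc n - k = (l - k) + Suc n" using kl by simp
    moreover have "l - k < Suc n" using l by simp
    ultimately show ?thesis by (simp only: mod_add_self2 mod_less)
  qed
  ultimately show ?thesis
    unfolding friese_val_def Let_def length_vs using k l kl vidx_nth by auto
qed

lemma polygon_labelling:
  obtains w where "\<And>x y. x \<in> set vs \<Longrightarrow> y \<in> set vs \<Longrightarrow> edge T x y \<Longrightarrow> det (w x) (w y) = 1"
    and "\<And>x y. x \<in> set vs \<Longrightarrow> y \<in> set vs \<Longrightarrow> x \<prec> y \<Longrightarrow>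
      det (w x) (w y) \<ge> 1 \<and> (det (w x) (w y) = 1 \<longleftrightarrow> edge T x y)"
proof -
  have n: "0 < n" by (simp add: n_def)
  \<comment> \<open>The standard basis labels the ends of the base \<open>Conn p q\<close>; the
    other labels follow from it.\<close>
  have "det (1, 0) (0, 1) = 1" by (simp add: det_def)
  then obtain w' where w': "labels E 0 n w'"
    using labels_exist[OF triangulates_polygon n] by blast
  define w where "w x = w' (vidx vs x)" for x
  have *: "det (w x) (w y) \<ge> 1 \<and> (det (w x) (w y) = 1 \<longleftrightarrow> edge T x y)"
    if xy: "x \<in> set vs" "y \<in> set vs" "x \<prec> y" for x y
  proof -
    obtain k l where k: "k \<le> n" "vs ! k = x" and l: "l \<le> n" "vs ! l = y"
      using ex_index xy by meson
    then have "k < l" using xy(3) nth_precedes_iff by auto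
    moreover have "w x = w' k" "w y = w' l" using k l vidx_nth by (auto simp: w_def)
    ultimately show ?thesis using labels_det[OF triangulates_polygon n w', of k l] k l by auto
  qed
  show thesis by (rule that[of w]) (use * edge_precedes[OF T] in blast)+
qed

end

section \<open>From triangulations to tilings\<close>

lemma polygon_around:
  assumes "is_triangulation T" "a \<le> b" "c \<le> d"
  obtains p q r s where "strip_polygon p q r s T" "p < a" "b < r" "s < c" "d < q"
proof -
  obtain p q r s where "Conn p q \<in> T" "p < a" "d < q" "Conn r s \<in> T" "b < r" "s < c"
    using assms(1) unfolding is_triangulation_def by meson
  then show thesis using that[of p q r s] assms by (simp add: strip_polygon_def strip_polygon_axioms_def strip_rectangle_def)
qed

text \<open>Unfolds the choice in \<open>Phi\<close>: the chosen polygon remains unknown, only its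
  position around the two vertices is available.\<close>

lemma Phi_eq_friese_val:
  assumes "is_triangulation T"
  obtains p q r s where "strip_polygon p q r s T" "p < i" "i < r" "s < j" "j < q"
    "Phi T i j = friese_val (strip_poly p r s q) (restrict_triang T (strip_poly p r s q)) (Up i) (Lo j)"
proof -
  let ?Q = "\<lambda>(p, q, r, s). Conn p q \<in> T \<and> Conn r s \<in> T \<and> p < i \<and> i < r \<and> s < j \<and> j < q"
  obtain p q r s where P: "Eps ?Q = (p, q, r, s)" by (rule prod_cases4)
  obtain p' q' r' s' where "strip_polygon p' q' r' s' T" "p' < i" "i < r'" "s' < j" "j < q'"
    using polygon_around[OF assms, of i i j j] by blast
  then have "?Q (p', q', r', s')" by (simp add: strip_polygon_def strip_polygon_axioms_def strip_rectangle_def)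
  then have "?Q (Eps ?Q)" by (rule someI)
  then have Q: "Conn p q \<in> T" "Conn r s \<in> T" "p < i" "i < r" "s < j" "j < q"
    unfolding P by auto
  then have "strip_polygon p q r s T" using assms by (simp add: strip_polygon_def strip_polygon_axioms_def strip_rectangle_def)
  moreover have "Phi T i j = friese_val (strip_poly p r s q) (restrict_triang T (strip_poly p r s q)) (Up i) (Lo j)"
    by (simp only: Phi_def P prod.case Let_def)
  ultimately show thesis using that Q by blast
qed

text \<open>Independence of the chosen polygon. A third polygon containing both the chosen and the
  given one has a labelling that restricts to each of them, so both friese values are the same
  determinant.\<close>

lemma (in strip_polygon) Phi_eq_det:
  assumes w: "\<And>x y. x \<in> set vs \<Longrightarrow> y \<in> set vs \<Longrightarrow> edge T x y \<Longrightarrow> det (w x) (w y) = 1"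
    and ij: "p < i" "i < r" "s < j" "j < q"
  shows "Phi T i j = det (w (Up i)) (w (Lo j))"
proof -
  obtain p' q' r' s' where P': "strip_polygon p' q' r' s' T" "p' < i" "i < r'" "s' < j" "j < q'"
    and Phi: "Phi T i j = friese_val (strip_poly p' r' s' q') (restrict_triang T (strip_poly p' r' s' q')) (Up i) (Lo j)"
    using Phi_eq_friese_val[OF T] by metis
  obtain p'' q'' r'' s'' where P'': "strip_polygon p'' q'' r'' s'' T"
    "p'' < min p p'" "max r r' < r''" "s'' < min s s'" "max q q' < q''"
    by (rule polygon_around[OF T, of "min p p'" "max r r'" "min s s'" "max q q'"]) (use pr sq in auto)
  interpret P': strip_polygon p' q' r' s' T by fact
  interpret P'': strip_polygon p'' q'' r'' s'' T by fact
  obtain w'' where w'': "\<And>x y. x \<in> set P''.vs \<Longrightarrow> y \<in> set P''.vs \<Longrightarrow> edge T x y \<Longrightarrow> det (w'' x) (w'' y) = 1"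
    using P''.polygon_labelling by metis
  have sub: "set vs \<subseteq> set P''.vs" "set P'.vs \<subseteq> set P''.vs"
    using P'' by (auto simp: vs_def P'.vs_def P''.vs_def strip_poly_def)
  have "Phi T i j = friese_val P'.vs P'.D (Up i) (Lo j)" using Phi by (simp add: P'.vs_def)
  also have "\<dots> = det (w'' (Up i)) (w'' (Lo j))"
    using P' sub by (intro P'.friese_val_eq_det w'') auto
  also have "\<dots> = friese_val vs D (Up i) (Lo j)"
    using ij sub by (intro friese_val_eq_det[symmetric] w'') auto
  also have "\<dots> = det (w (Up i)) (w (Lo j))"
    using ij by (intro friese_val_eq_det w) auto
  finally show ?thesis .
qed

fun height :: "vert \<Rightarrow> int" where
  "height (Up a) = \<bar>a\<bar>"
| "height (Lo b) = \<bar>b\<bar>"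

text \<open>Labels are produced only on a finite window around 0. This suffices, since each property
  of \<open>Phi T\<close> to be shown concerns finitely many vertices at a time.\<close>

lemma local_labelling:
  assumes T: "is_triangulation T"
  obtains w where "\<And>i j. \<bar>i\<bar> \<le> N \<Longrightarrow> \<bar>j\<bar> \<le> N \<Longrightarrow> Phi T i j = det (w (Up i)) (w (Lo j))"
    and "\<And>x y. x \<prec> y \<Longrightarrow> height x \<le> N \<Longrightarrow> height y \<le> N \<Longrightarrow>
      det (w x) (w y) \<ge> 1 \<and> (det (w x) (w y) = 1 \<longleftrightarrow> edge T x y)"
proof (cases "N \<ge> 0")
  case True
  obtain p q r s where P: "strip_polygon p q r s T" "p < -N" "N < r" "s < -N" "N < q"
    by (rule polygon_around[OF T, of "-N" N "-N" N]) (use True in auto)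
  then interpret strip_polygon p q r s T by simp
  obtain w where w: "\<And>x y. x \<in> set vs \<Longrightarrow> y \<in> set vs \<Longrightarrow> edge T x y \<Longrightarrow> det (w x) (w y) = 1"
    "\<And>x y. x \<in> set vs \<Longrightarrow> y \<in> set vs \<Longrightarrow> x \<prec> y \<Longrightarrow>
      det (w x) (w y) \<ge> 1 \<and> (det (w x) (w y) = 1 \<longleftrightarrow> edge T x y)"
    using polygon_labelling by metis
  show thesis
  proof (rule that[of w])
    show "Phi T i j = det (w (Up i)) (w (Lo j))" if "\<bar>i\<bar> \<le> N" "\<bar>j\<bar> \<le> N" for i j
      by (rule Phi_eq_det[OF w(1)]) (use that P in auto)
    show "det (w x) (w y) \<ge> 1 \<and> (det (w x) (w y) = 1 \<longleftrightarrow> edge T x y)"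
      if "x \<prec> y" "height x \<le> N" "height y \<le> N" for x y
      by (rule w(2)) (use that P in \<open>(cases x; cases y; auto)+\<close>)
  qed
next
  \<comment> \<open>No vertex has negative height, so the window is empty and any labelling
    serves.\<close>
  case False
  moreover have "height x \<ge> 0" for x by (cases x) auto
  ultimately show thesis using that[of "\<lambda>_. (0, 0)"] by (metis abs_ge_zero order_trans)
qed

text \<open>The determinant of the labels at the ends of an arc, written in terms of the tiling.\<close>
fun arc_value :: "(int \<Rightarrow> int \<Rightarrow> int) \<Rightarrow> arc \<Rightarrow> int" where
  "arc_value t (Conn p q) = t p q"
| "arc_value t (UArc a b) = t a 0 * t b 1 - t a 1 * t b 0"
| "arc_value t (LArc a b) = t 0 a * t 1 b - t 1 a * t 0 b"

text \<open>The inverse of \<open>Phi\<close>.\<close>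

definition unit_arcs :: "(int \<Rightarrow> int \<Rightarrow> int) \<Rightarrow> arc set" where
  "unit_arcs t = {z. is_arc z \<and> arc_value t z = 1}"

text \<open>Multiplicativity of 2 by 2 determinants, for the matrix of pairings of \<open>a\<close>,
  \<open>b\<close> with \<open>c\<close>, \<open>d\<close>. It yields both the SL2 rule for adjacent
  entries and the formulas in \<open>arc_value\<close>.\<close>

lemma det_product: "det a c * det b d - det a d * det b c = det a b * det c d"
  by (simp add: det_def algebra_simps)

lemma arc_value_eq_det:
  assumes t: "\<And>i j. \<bar>i\<bar> \<le> N \<Longrightarrow> \<bar>j\<bar> \<le> N \<Longrightarrow> t i j = det (w (Up i)) (w (Lo j))"
    and "det (w (Up 0)) (w (Up 1)) = 1" "det (w (Lo 0)) (w (Lo 1)) = 1"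
    and "height (src z) \<le> N" "height (tgt z) \<le> N" "1 \<le> N"
  shows "arc_value t z = det (w (src z)) (w (tgt z))"
proof (cases z)
  case (UArc a b)
  then have "\<bar>a\<bar> \<le> N" "\<bar>b\<bar> \<le> N" using assms by auto
  then show ?thesis using UArc assms by (simp add: t det_product)
next
  case (LArc a b)
  then have "\<bar>a\<bar> \<le> N" "\<bar>b\<bar> \<le> N" using assms by auto
  then show ?thesis
    using LArc assms det_product[of "w (Up 0)" "w (Lo a)" "w (Up 1)" "w (Lo b)"]
    by (simp add: t algebra_simps)
qed (use assms(4,5) in \<open>auto intro!: t\<close>)

lemma edge_consecutive: "edge T (Up 0) (Up 1)" "edge T (Lo 0) (Lo 1)" "edge T (Up a) (Up (a + 1))"
    "edge T (Lo a) (Lo (a + 1))"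
  by (auto simp: edge_def)

text \<open>In a window containing both ends, \<open>arc_value\<close> is the determinant of the
  labels, which is 1 exactly on edges. Hence \<open>Phi\<close> is injective.\<close>

lemma unit_arcs_Phi:
  assumes T: "is_triangulation T"
  shows "unit_arcs (Phi T) = T"
proof -
  have "z \<in> unit_arcs (Phi T) \<longleftrightarrow> z \<in> T" if z: "is_arc z" for z
  proof -
    obtain N where N: "height (src z) \<le> N" "height (tgt z) \<le> N" "1 \<le> N"
      using that[of "max 1 (max (height (src z)) (height (tgt z)))"] by auto
    obtain w where w: "\<And>i j. \<bar>i\<bar> \<le> N \<Longrightarrow> \<bar>j\<bar> \<le> N \<Longrightarrow> Phi T i j = det (w (Up i)) (w (Lo j))"
      "\<And>x y. x \<prec> y \<Longrightarrow> height x \<le> N \<Longrightarrow> height y \<le> N \<Longrightarrow>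
      det (w x) (w y) \<ge> 1 \<and> (det (w x) (w y) = 1 \<longleftrightarrow> edge T x y)"
      using local_labelling[OF T] by metis
    have "det (w (Up 0)) (w (Up 1)) = 1" "det (w (Lo 0)) (w (Lo 1)) = 1"
      using w(2)[of "Up 0" "Up 1"] w(2)[of "Lo 0" "Lo 1"] N(3) edge_consecutive by auto
    then have "arc_value (Phi T) z = det (w (src z)) (w (tgt z))"
      using arc_value_eq_det[OF w(1) _ _ N] by blast
    then show ?thesis
      using w(2)[OF src_precedes_tgt[OF z] N(1,2)] edge_src_tgt[OF z] z by (simp add: unit_arcs_def)
  qed
  moreover have "is_arc z" if "z \<in> T" for z using T that by (auto simp: is_triangulation_def)
  ultimately show ?thesis by (auto simp: unit_arcs_def)
qed

lemma Phi_SL2_tiling: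
  assumes T: "is_triangulation T"
  shows "is_SL2_tiling (Phi T)"
  unfolding is_SL2_tiling_def
proof (intro conjI allI)
  fix i j :: int
  let ?N = "\<bar>i\<bar> + \<bar>j\<bar> + 1"
  obtain w where w: "\<And>i j. \<bar>i\<bar> \<le> ?N \<Longrightarrow> \<bar>j\<bar> \<le> ?N \<Longrightarrow> Phi T i j = det (w (Up i)) (w (Lo j))"
    "\<And>x y. x \<prec> y \<Longrightarrow> height x \<le> ?N \<Longrightarrow> height y \<le> ?N \<Longrightarrow>
    det (w x) (w y) \<ge> 1 \<and> (det (w x) (w y) = 1 \<longleftrightarrow> edge T x y)"
    using local_labelling[OF T, of ?N] by metis
  show "Phi T i j \<ge> 1"
    using w(1)[of i j] w(2)[of "Up i" "Lo j"] by auto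
  have "det (w (Up i)) (w (Up (i + 1))) = 1" "det (w (Lo j)) (w (Lo (j + 1))) = 1"
    using w(2)[of "Up i" "Up (i + 1)"] w(2)[of "Lo j" "Lo (j + 1)"] edge_consecutive by auto
  moreover have "Phi T i j = det (w (Up i)) (w (Lo j))"
    "Phi T (i + 1) j = det (w (Up (i + 1))) (w (Lo j))"
    "Phi T i (j + 1) = det (w (Up i)) (w (Lo (j + 1)))"
    "Phi T (i + 1) (j + 1) = det (w (Up (i + 1))) (w (Lo (j + 1)))"
    by (rule w(1); linarith)+
  ultimately show "Phi T i j * Phi T (i + 1) (j + 1) - Phi T i (j + 1) * Phi T (i + 1) j = 1"
    using det_product[of "w (Up i)" "w (Lo j)" "w (Up (i + 1))" "w (Lo (j + 1))"] by simp
qed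

lemma Phi_enough_ones:
  assumes T: "is_triangulation T"
  shows "enough_ones (Phi T)"
proof -
  have "Phi T p q = 1" if "Conn p q \<in> T" for p q
    using that unit_arcs_Phi[OF T] by (auto simp: unit_arcs_def set_eq_iff dest: spec[of _ "Conn p q"])
  then show ?thesis using T unfolding enough_ones_def is_triangulation_def by meson
qed

section \<open>From tilings to triangulations\<close>

locale SL2_tiling_ones =
  fixes t :: "int \<Rightarrow> int \<Rightarrow> int"
  assumes tiling: "is_SL2_tiling t" and ones: "enough_ones t"
begin

lemma pos: "t i j \<ge> 1"
  using tiling by (simp add: is_SL2_tiling_def)

lemma minor: "t i j * t (i + 1) (j + 1) - t i (j + 1) * t (i + 1) j = 1"
  using tiling by (simp add: is_SL2_tiling_def)

text \<open>The labels satisfy \<open>t i j = det (W (Up i)) (W (Lo j))\<close>; the formula for \<open>W (Lo j)\<close> solves this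
  for \<open>i = 0, 1\<close>.\<close>
definition u :: "int \<Rightarrow> int \<times> int" where "u i = (t i 0, t i 1)"

fun W :: "vert \<Rightarrow> int \<times> int" where
  "W (Up i) = u i"
| "W (Lo j) = (t 0 j * fst (u 1) - t 1 j * fst (u 0), t 0 j * snd (u 1) - t 1 j * snd (u 0))"

text \<open>The ratio \<open>(t (i + 1) j + t (i - 1) j) / t i j\<close> does not depend on \<open>j\<close>.\<close>
lemma row_recurrence:
  "(t (i + 1) j + t (i - 1) j) * t i 0 = (t (i + 1) 0 + t (i - 1) 0) * t i j"
proof -
  \<comment> \<open>The two vertically adjacent minors both equal 1; equating them shows that the
    ratio agrees in columns \<open>j\<close> and \<open>j + 1\<close>.\<close>
  have step: "(t (i + 1) j + t (i - 1) j) * t i (j + 1) = (t (i + 1) (j + 1) + t (i - 1) (j + 1)) * t i j" for j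
    using minor[of i j] minor[of "i - 1" j] by (simp add: algebra_simps)
  have nz: "t i j \<noteq> 0" for j using pos[of i j] by simp
  show ?thesis
  proof (induction j rule: int_induct[where k = 0])
    case (step1 j)
    \<comment> \<open>The extra factor \<open>t i j\<close> allows the two proportions to be
      chained; being nonzero, it is cancelled afterwards.\<close>
    have "((t (i + 1) (j + 1) + t (i - 1) (j + 1)) * t i 0) * t i j =
        ((t (i + 1) 0 + t (i - 1) 0) * t i (j + 1)) * t i j"
      using step1(2) step[of j] by algebra
    then show ?case using nz by simp
  next
    case (step2 j)
    have "((t (i + 1) (j - 1) + t (i - 1) (j - 1)) * t i 0) * t i j =
        ((t (i + 1) 0 + t (i - 1) 0) * t i (j - 1)) * t i j"
      using step2(2) step[of "j - 1"] by (simp, algebra)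
    then show ?case using nz by simp
  qed simp
qed

lemma det_u_01: "det (u 0) (u 1) = 1"
  using minor[of 0 0] by (simp add: u_def det_def mult.commute)

text \<open>For fixed \<open>j\<close>, both sides satisfy the same three-term recurrence in
  \<open>i\<close> and agree at 0 and 1. The coefficient \<open>t i 0\<close> is nonzero, so the
  recurrence can be solved upwards and downwards.\<close>

lemma t_eq_det: "t i j = det (W (Up i)) (W (Lo j))"
proof -
  define f where "f i = det (u i) (W (Lo j))" for i
  have f01: "f 0 = t 0 j" "f 1 = t 1 j"
    using det_u_01 unfolding f_def by (auto simp: det_def) algebra+
  \<comment> \<open>\<open>f i\<close> is a linear combination, with coefficients independent of
    \<open>i\<close>, of the entries of row \<open>i\<close> in columns 0 and 1. Column 0 satisfies
    the recurrence trivially, column 1 by \<open>row_recurrence\<close>.\<close>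
  have f: "(f (i + 1) + f (i - 1)) * t i 0 = (t (i + 1) 0 + t (i - 1) 0) * f i" for i
    using row_recurrence[of i 1] unfolding f_def det_def u_def by simp algebra
  have nz: "t i 0 \<noteq> 0" for i using pos[of i 0] by simp
  have "f i = t i j \<and> f (i + 1) = t (i + 1) j" for i
  proof (induction i rule: int_induct[where k = 0])
    case base
    then show ?case using f01 by simp
  next
    case (step1 i)
    then have eq: "f i = t i j" "f (i + 1) = t (i + 1) j" by auto
    have "(f (i + 1 + 1) + t i j) * t (i + 1) 0 = (t (i + 1 + 1) j + t i j) * t (i + 1) 0"
      using f[of "i + 1"] row_recurrence[of "i + 1" j] unfolding add_diff_cancel_right' eq by metis
    then show ?case using nz[of "i + 1"] eq by simp
  next
    case (step2 i)
    then have eq: "f i = t i j" "f (i + 1) = t (i + 1) j" by auto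
    have "(t (i + 1) j + f (i - 1)) * t i 0 = (t (i + 1) j + t (i - 1) j) * t i 0"
      using f[of i] row_recurrence[of i j] unfolding eq by metis
    then show ?case using nz[of i] eq by simp
  qed
  then show ?thesis by (simp add: f_def)
qed

lemma det_Up_succ: "det (W (Up a)) (W (Up (a + 1))) = 1"
  using minor[of a 0] by (simp add: u_def det_def mult.commute)

lemma det_Lo: "det (W (Lo a)) (W (Lo b)) = t 0 a * t 1 b - t 1 a * t 0 b"
  using det_u_01 by (simp add: det_def) algebra

lemma det_Lo_succ: "det (W (Lo a)) (W (Lo (a + 1))) = 1"
  using minor[of 0 a] by (simp add: det_Lo mult.commute del: W.simps)

text \<open>The Pluecker relation with \<open>W (Lo 0)\<close> as fourth vector expresses the next
  determinant, times the positive entry \<open>t b 0\<close>, through positive quantities.\<close>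

lemma det_Up_pos: "a < b \<Longrightarrow> det (W (Up a)) (W (Up b)) \<ge> 1"
proof (induction b rule: int_gr_induct)
  case base
  then show ?case using det_Up_succ by simp
next
  case (step b)
  have "det (W (Up a)) (W (Up (b + 1))) * t b 0 =
      det (W (Up a)) (W (Up b)) * t (b + 1) 0 + t a 0"
    using pluecker[of "W (Up a)" "W (Up (b + 1))" "W (Up b)" "W (Lo 0)"] det_Up_succ[of b]
    by (simp only: t_eq_det)
  moreover have "\<dots> > 0" using step pos[of "b + 1" 0] pos[of a 0] by (intro add_nonneg_pos mult_nonneg_nonneg) auto
  ultimately have "det (W (Up a)) (W (Up (b + 1))) * t b 0 > 0" by simp
  then show ?case using pos[of b 0] by (simp add: zero_less_mult_iff)
qed

lemma det_Lo_pos: "a < b \<Longrightarrow> det (W (Lo a)) (W (Lo b)) \<ge> 1"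
proof (induction b rule: int_gr_induct)
  case base
  then show ?case using det_Lo_succ by simp
next
  case (step b)
  have "det (W (Lo a)) (W (Lo (b + 1))) * t 0 b =
      det (W (Lo a)) (W (Lo b)) * t 0 (b + 1) + t 0 a"
    using pluecker[of "W (Lo a)" "W (Lo (b + 1))" "W (Lo b)" "W (Up 0)"] det_Lo_succ[of b]
      det_swap[of "W (Lo a)" "W (Up 0)"] det_swap[of "W (Lo b)" "W (Up 0)"]
      det_swap[of "W (Lo (b + 1))" "W (Up 0)"]
    by (simp add: t_eq_det[symmetric] del: W.simps)
  moreover have "\<dots> > 0" using step pos[of 0 "b + 1"] pos[of 0 a] by (intro add_nonneg_pos mult_nonneg_nonneg) auto
  ultimately have "det (W (Lo a)) (W (Lo (b + 1))) * t 0 b > 0" by simp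
  then show ?case using pos[of 0 b] by (simp add: zero_less_mult_iff)
qed

lemma det_W_pos:
  assumes "x \<prec> y"
  shows "det (W x) (W y) \<ge> 1"
  using assms
proof (cases x; cases y)
  fix i j assume "x = Up i" "y = Lo j"
  then show ?thesis using pos[of i j] by (simp only: t_eq_det)
qed (use det_Up_pos det_Lo_pos in \<open>auto simp del: W.simps\<close>)

lemma arc_value_eq: "arc_value t z = det (W (src z)) (W (tgt z))"
proof (cases z)
  case (Conn p q)
  then show ?thesis by (simp only: arc_value.simps src.simps tgt.simps t_eq_det)
next
  case (UArc a b)
  then show ?thesis by (simp add: u_def det_def)
next
  case (LArc a b)
  then show ?thesis by (simp only: arc_value.simps src.simps tgt.simps det_Lo)
qed

section \<open>The arcs of determinant 1 form a triangulation\<close>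

lemma edge_unit_arcs: "edge (unit_arcs t) x y \<longleftrightarrow> x \<prec> y \<and> det (W x) (W y) = 1"
proof
  assume "edge (unit_arcs t) x y"
  then consider "consecutive x y" | z where "z \<in> unit_arcs t" "src z = x" "tgt z = y"
    by (auto simp: edge_def)
  then show "x \<prec> y \<and> det (W x) (W y) = 1"
  proof cases
    case 1
    then show ?thesis
      using det_Up_succ det_Lo_succ by (cases x; cases y) (auto simp del: W.simps)
  next
    case 2
    then show ?thesis using src_precedes_tgt[of z] arc_value_eq by (auto simp: unit_arcs_def)
  qed
next
  assume *: "x \<prec> y \<and> det (W x) (W y) = 1"
  show "edge (unit_arcs t) x y"
  proof (cases "consecutive x y")
    case False
    then obtain z where "is_arc z" "src z = x" "tgt z = y" using arc_between * by blast
    then have "z \<in> unit_arcs t" using * arc_value_eq by (simp add: unit_arcs_def)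
    then show ?thesis using \<open>src z = x\<close> \<open>tgt z = y\<close> by (auto simp: edge_def)
  qed (simp add: edge_def)
qed

lemma unit_arcs_connecting: "Conn p q \<in> unit_arcs t \<longleftrightarrow> t p q = 1"
  by (simp add: unit_arcs_def)

text \<open>The Pluecker relation would write 1 as a sum of two products, each at least 1.\<close>

lemma unit_arcs_noncrossing:
  assumes "det (W x) (W y) = 1" "det (W z) (W v) = 1" "x \<prec> z" "z \<prec> y" "y \<prec> v"
  shows False
proof -
  have 1: "det (W x) (W z) \<ge> 1" "det (W y) (W v) \<ge> 1" "det (W x) (W v) \<ge> 1" "det (W z) (W y) \<ge> 1"
    using assms det_W_pos precedes_trans by blast+
  have "det (W x) (W z) * det (W y) (W v) \<ge> 1" "det (W x) (W v) * det (W z) (W y) \<ge> 1"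
    using 1 mult_mono[of 1 "det (W x) (W z)" 1 "det (W y) (W v)"]
      mult_mono[of 1 "det (W x) (W v)" 1 "det (W z) (W y)"] by simp_all
  then show False using pluecker[of "W x" "W y" "W z" "W v"] assms by simp
qed

text \<open>Having enough ones provides two connecting arcs of value 1 that enclose \<open>z\<close>
  in a polygon. All sides of this polygon have determinant 1, so \<open>unimodular_crossed\<close>
  finds a crossing pair of determinant 1.\<close>

lemma unit_arcs_maximal:
  assumes "is_arc z" "z \<notin> unit_arcs t"
  obtains y where "y \<in> unit_arcs t" "crosses z y"
proof -
  define N where "N = max (height (src z)) (height (tgt z))"
  obtain p q r s where P: "t p q = 1" "p < -N" "N < q" "t r s = 1" "N < r" "s < -N"
    using ones unfolding enough_ones_def by meson
  have N: "height (src z) \<le> N" "height (tgt z) \<le> N" "0 \<le> N"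
    unfolding N_def by (cases z; auto)+
  interpret strip_rectangle p q r s using P N by unfold_locales auto
  have "src z \<in> set vs" "tgt z \<in> set vs"
    using P N by (cases "src z"; cases "tgt z"; auto)+
  then obtain i j where i: "i \<le> n" "vs ! i = src z" and j: "j \<le> n" "vs ! j = tgt z"
    using ex_index by meson
  then have ij: "i < j" using src_precedes_tgt[OF assms(1)] nth_precedes_iff[of i j] by simp
  have "\<exists>k l. 0 \<le> k \<and> k < l \<and> l \<le> n \<and> det (W (vs ! k)) (W (vs ! l)) = 1 \<and>
    (i < k \<and> k < j \<and> j < l \<or> k < i \<and> i < l \<and> l < j)"
  proof (rule unimodular_crossed)
    show "det (W (vs ! i)) (W (vs ! j)) \<ge> 1" if "i < j" "j \<le> n" for i j
      using that nth_precedes det_W_pos by simp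
    show "det (W (vs ! i)) (W (vs ! Suc i)) = 1" if "i < n" for i
    proof (cases "consecutive (vs ! i) (vs ! Suc i)")
      case True
      then have "edge (unit_arcs t) (vs ! i) (vs ! Suc i)" by (simp add: edge_def)
      then show ?thesis using edge_unit_arcs by blast
    next
      case False
      then have "vs ! i = Up r" "vs ! Suc i = Lo s" using nth_Suc[OF that] by auto
      then show ?thesis using P(4) t_eq_det by metis
    qed
    show "det (W (vs ! 0)) (W (vs ! n)) = 1"
      using P(1) t_eq_det nth_0 nth_n by metis
    show "det (W (vs ! i)) (W (vs ! j)) \<noteq> 1"
      using assms arc_value_eq i j by (simp add: unit_arcs_def)
  qed (use i j ij in auto)
  then obtain k l where kl: "k < l" "l \<le> n" "det (W (vs ! k)) (W (vs ! l)) = 1"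
    "i < k \<and> k < j \<and> j < l \<or> k < i \<and> i < l \<and> l < j" by blast
  then have ord: "src z \<prec> vs ! k \<and> vs ! k \<prec> tgt z \<and> tgt z \<prec> vs ! l \<or>
      vs ! k \<prec> src z \<and> src z \<prec> vs ! l \<and> vs ! l \<prec> tgt z"
    unfolding i(2)[symmetric] j(2)[symmetric] using i(1) j(1) by (simp add: nth_precedes_iff)
  \<comment> \<open>Nothing lies between the ends of a boundary segment, so the crossing pair comes
    from an arc.\<close>
  then have "\<not> consecutive (vs ! k) (vs ! l)" using consecutive_no_between by blast
  then obtain y where y: "is_arc y" "src y = vs ! k" "tgt y = vs ! l"
    using arc_between nth_precedes kl by blast
  then have "y \<in> unit_arcs t" using kl arc_value_eq by (simp add: unit_arcs_def)
  moreover have "crosses z y" using crosses_iff_interleaved[OF assms(1) y(1)] ord y by simp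
  ultimately show thesis using that by blast
qed

lemma is_triangulation_unit_arcs: "is_triangulation (unit_arcs t)"
  unfolding is_triangulation_def
proof (intro conjI ballI allI impI notI)
  fix y z assume yz: "y \<in> unit_arcs t" "z \<in> unit_arcs t" and "crosses y z"
  then have "is_arc y" "is_arc z" "det (W (src y)) (W (tgt y)) = 1" "det (W (src z)) (W (tgt z)) = 1"
    using arc_value_eq by (auto simp: unit_arcs_def)
  then show False
    using crosses_iff_interleaved \<open>crosses y z\<close> unit_arcs_noncrossing by blast
next
  fix z assume z: "is_arc z \<and> z \<notin> unit_arcs t"
  then obtain y where "y \<in> unit_arcs t" "crosses z y" using unit_arcs_maximal by blast
  then show "\<exists>y\<in>unit_arcs t. y \<noteq> z \<and> crosses z y"
    using z by (intro bexI[of _ y]) auto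
next
  fix i j
  show "\<exists>p q. Conn p q \<in> unit_arcs t \<and> p < i \<and> j < q"
    "\<exists>p q. Conn p q \<in> unit_arcs t \<and> i < p \<and> q < j"
    using ones unfolding enough_ones_def unit_arcs_connecting by meson+
qed (simp add: unit_arcs_def)

text \<open>\<open>W\<close> has determinant 1 along all edges, so it restricts to a labelling of
  any polygon and computes \<open>Phi\<close> there.\<close>

lemma Phi_unit_arcs: "Phi (unit_arcs t) = t"
proof (intro ext)
  fix i j
  obtain p q r s where P: "strip_polygon p q r s (unit_arcs t)" "p < i" "i < r" "s < j" "j < q"
    using polygon_around[OF is_triangulation_unit_arcs, of i i j j] by blast
  have "Phi (unit_arcs t) i j = det (W (Up i)) (W (Lo j))"
    by (rule strip_polygon.Phi_eq_det[OF P(1) _ P(2-5)]) (use edge_unit_arcs in blast)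
  then show "Phi (unit_arcs t) i j = t i j" by (simp only: t_eq_det)
qed

end

theorem mainTheorem1:
  shows "bij_betw Phi {T. is_triangulation T} {t. is_SL2_tiling t \<and> enough_ones t}"
proof (rule bij_betw_byWitness[where f' = unit_arcs])
  show "\<forall>T\<in>{T. is_triangulation T}. unit_arcs (Phi T) = T"
    using unit_arcs_Phi by blast
  show "\<forall>t\<in>{t. is_SL2_tiling t \<and> enough_ones t}. Phi (unit_arcs t) = t"
    using SL2_tiling_ones.Phi_unit_arcs SL2_tiling_ones.intro by blast
  show "Phi ` {T. is_triangulation T} \<subseteq> {t. is_SL2_tiling t \<and> enough_ones t}"
    using Phi_SL2_tiling Phi_enough_ones by blast
  show "unit_arcs ` {t. is_SL2_tiling t \<and> enough_ones t} \<subseteq> {T. is_triangulation T}"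
    using SL2_tiling_ones.is_triangulation_unit_arcs SL2_tiling_ones.intro by blast
qed

end
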